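(* For any sentence $\phi$ in the language of $\mathsf{LT}$ (only primitive $\in$): (1) if $\mathsf{LT}\vdash\phi$ then $\mathsf{BLT}\vdash\phi^{h}$; (2) if $\mathsf{LT}^{+}\vdash\phi$ then $\mathsf{BLT}^{+}\vdash\phi^{h}$; (3) if $\mathsf{ZF}\vdash\phi$ then $\mathsf{BLT}_{\mathsf{ZF}}\vdash\phi^{h}$; where $\phi^{h}$ is the result of restricting all quantifiers of $\phi$ to helow sets.
   Context: A set $a$ is helow iff there is a transitive set $c\supseteq a$ such that every $x\in c$ satisfies $x\notin x$. Ordinary level notions: $\mathrm{pot}(a)=\{x:\exists c(x\subseteq c\wedge c\in a)\}$; a history is $h$ with $x=\mathrm{pot}(x\cap h)$ for $x\in h$; a level is $\mathrm{pot}(h)$ for a history $h$. $\mathsf{LT}$: second-order theory with Extensionality, Separation $\forall F\forall a\exists b\forall x(x\in b\leftrightarrow(F(x)\wedge x\in a))$, Stratification (every set is a subset of a level). $\mathsf{LT}^{+}=\mathsf{LT}+$Endless (every level is a member of some level). Boolean notions: $\overline{a}=\{x:x\notin a\}$; $\mathrm{bpot}(a)=\{x:\exists c(c\in a\wedge c\notin c\wedge(x\subseteq c\vee\overline{x}\subseteq c))\}$; a boolean-history is $h$ with $h\notin h$ and $x=\mathrm{bpot}(x\cap h)$ for $x\in h$; a boolean-level is $\mathrm{bpot}(h)$ for a boolean-history $h$. $\mathsf{BLT}$: Extensionality; Complements $\forall a\exists c(c=\overline{a}\wedge(a\notin a\leftrightarrow c\in c))$; Separation$_\notin$ $\forall F\forall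 a(a\notin a\to\exists b(b\notin b\wedge\forall x(x\in b\leftrightarrow(F(x)\wedge x\in a))))$; Stratification$_\notin$ (every $a\notin a$ is a subset of a boolean-level). Endless$_\notin$: every boolean-level is a member of some boolean-level. Infinity$_\notin$: some boolean-level $s$ contains a boolean-level, and for every boolean-level $q\in s$ there is a boolean-level $r$ with $q\in r\in s$. Unbounded$_\notin$: $\forall P\forall a(a\notin a\to\exists s(s\text{ a boolean-level}\wedge\forall x\in a\,P(x)\in s))$. $\mathsf{BLT}^{+}=\mathsf{BLT}+$Endless$_\notin$; $\mathsf{BLT}_{\mathsf{ZF}}=\mathsf{BLT}+$Infinity$_\notin+$Unbounded$_\notin$. *)

theory Defs
  imports Main
begin

type_synonym rvar = "nat \<times> nat"

datatype form =
    Mem nat nat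
  | Eq nat nat
  | Rel rvar "nat list"
  | Bot
  | Imp form form
  | All nat form
  | AllR rvar form

definition Neg :: "form \<Rightarrow> form" where "Neg p = Imp p Bot"
definition Or :: "form \<Rightarrow> form \<Rightarrow> form" where "Or p q = Imp (Neg p) q"
definition And :: "form \<Rightarrow> form \<Rightarrow> form" where "And p q = Neg (Imp p (Neg q))"
definition Iff :: "form \<Rightarrow> form \<Rightarrow> form" where "Iff p q = And (Imp p q) (Imp q p)"
definition Ex :: "nat \<Rightarrow> form \<Rightarrow> form" where "Ex x p = Neg (All x (Neg p))"
definition ExR :: "rvar \<Rightarrow> form \<Rightarrow> form" where "ExR r p = Neg (AllR r (Neg p))"

fun alls :: "nat list \<Rightarrow> form \<Rightarrow> form" where
  "alls [] p = p"
| "alls (v # vs) p = All v (alls vs p)"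

fun fv :: "form \<Rightarrow> nat set" where
  "fv (Mem a b) = {a, b}"
| "fv (Eq a b) = {a, b}"
| "fv (Rel r xs) = set xs"
| "fv Bot = {}"
| "fv (Imp p q) = fv p \<union> fv q"
| "fv (All x p) = fv p - {x}"
| "fv (AllR r p) = fv p"

fun frv :: "form \<Rightarrow> rvar set" where
  "frv (Mem a b) = {}"
| "frv (Eq a b) = {}"
| "frv (Rel r xs) = {r}"
| "frv Bot = {}"
| "frv (Imp p q) = frv p \<union> frv q"
| "frv (All x p) = frv p"
| "frv (AllR r p) = frv p - {r}"

fun wf :: "form \<Rightarrow> bool" where
  "wf (Rel r xs) = (length xs = snd r)"
| "wf (Imp p q) = (wf p \<and> wf q)"
| "wf (All x p) = wf p"
| "wf (AllR r p) = wf p"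
| "wf _ = True"

definition sentence :: "form \<Rightarrow> bool" where
  "sentence p \<longleftrightarrow> wf p \<and> fv p = {} \<and> frv p = {}"

definition sv :: "nat \<Rightarrow> nat \<Rightarrow> nat \<Rightarrow> nat" where
  "sv x y v = (if v = x then y else v)"

fun subst :: "nat \<Rightarrow> nat \<Rightarrow> form \<Rightarrow> form" where
  "subst x y (Mem a b) = Mem (sv x y a) (sv x y b)"
| "subst x y (Eq a b) = Eq (sv x y a) (sv x y b)"
| "subst x y (Rel r xs) = Rel r (map (sv x y) xs)"
| "subst x y Bot = Bot"
| "subst x y (Imp p q) = Imp (subst x y p) (subst x y q)"
| "subst x y (All z p) = (if z = x then All z p else All z (subst x y p))"
| "subst x y (AllR r p) = AllR r (subst x y p)"

fun free_for :: "nat \<Rightarrow> nat \<Rightarrow> form \<Rightarrow> bool" where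
  "free_for y x (Imp p q) = (free_for y x p \<and> free_for y x q)"
| "free_for y x (All z p) = (z = x \<or> x \<notin> fv p \<or> (z \<noteq> y \<and> free_for y x p))"
| "free_for y x (AllR r p) = free_for y x p"
| "free_for y x _ = True"

fun rsubst :: "rvar \<Rightarrow> rvar \<Rightarrow> form \<Rightarrow> form" where
  "rsubst R S (Rel r xs) = Rel (if r = R then S else r) xs"
| "rsubst R S (Imp p q) = Imp (rsubst R S p) (rsubst R S q)"
| "rsubst R S (All x p) = All x (rsubst R S p)"
| "rsubst R S (AllR r p) = (if r = R then AllR r p else AllR r (rsubst R S p))"
| "rsubst R S p = p"

fun rfree_for :: "rvar \<Rightarrow> rvar \<Rightarrow> form \<Rightarrow> bool" where
  "rfree_for S R (Imp p q) = (rfree_for S R p \<and> rfree_for S R q)"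
| "rfree_for S R (All x p) = rfree_for S R p"
| "rfree_for S R (AllR r p) = (r = R \<or> R \<notin> frv p \<or> (r \<noteq> S \<and> rfree_for S R p))"
| "rfree_for S R _ = True"

inductive logax :: "form \<Rightarrow> bool" where
  ax1: "logax (Imp p (Imp q p))"
| ax2: "logax (Imp (Imp p (Imp q r)) (Imp (Imp p q) (Imp p r)))"
| ax3: "logax (Imp (Neg (Neg p)) p)"
| inst: "free_for y x p \<Longrightarrow> logax (Imp (All x p) (subst x y p))"
| dist: "x \<notin> fv p \<Longrightarrow> logax (Imp (All x (Imp p q)) (Imp p (All x q)))"
| refl: "logax (Eq x x)"
| leibniz: "free_for x z p \<Longrightarrow> free_for y z p \<Longrightarrow>
            logax (Imp (Eq x y) (Imp (subst z x p) (subst z y p)))"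
| instR: "snd S = snd R \<Longrightarrow> rfree_for S R p \<Longrightarrow> logax (Imp (AllR R p) (rsubst R S p))"
| distR: "R \<notin> frv p \<Longrightarrow> logax (Imp (AllR R (Imp p q)) (Imp p (AllR R q)))"
| compr: "wf p \<Longrightarrow> R \<notin> frv p \<Longrightarrow> distinct vs \<Longrightarrow> length vs = snd R \<Longrightarrow>
          logax (ExR R (alls vs (Iff (Rel R vs) p)))"

inductive deriv :: "form set \<Rightarrow> form \<Rightarrow> bool" (infix "\<turnstile>" 55) where
  hyp: "p \<in> T \<Longrightarrow> T \<turnstile> p"
| log: "logax p \<Longrightarrow> T \<turnstile> p"
| mp: "T \<turnstile> Imp p q \<Longrightarrow> T \<turnstile> p \<Longrightarrow> T \<turnstile> q"
| gen: "T \<turnstile> p \<Longrightarrow> T \<turnstile> All x p"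
| genR: "T \<turnstile> p \<Longrightarrow> T \<turnstile> AllR R p"

section \<open>Defined notions (expanded into primitive formulas; bound variables chosen fresh)\<close>

definition Sub :: "nat \<Rightarrow> nat \<Rightarrow> form" where
  "Sub a b = (let z = Suc (max a b) in All z (Imp (Mem z a) (Mem z b)))"

definition CoSub :: "nat \<Rightarrow> nat \<Rightarrow> form" where
  "CoSub a b = (let z = Suc (max a b) in All z (Imp (Neg (Mem z a)) (Mem z b)))"

definition IsCompl :: "nat \<Rightarrow> nat \<Rightarrow> form" where
  "IsCompl c a = (let x = Suc (max c a) in All x (Iff (Mem x c) (Neg (Mem x a))))"

definition Trans :: "nat \<Rightarrow> form" where
  "Trans c = (let y = Suc c; z = Suc (Suc c) in
     All y (Imp (Mem y c) (All z (Imp (Mem z y) (Mem z c)))))"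

definition Helow :: "nat \<Rightarrow> form" where
  "Helow a = (let c = Suc a; y = Suc (Suc a) in
     Ex c (And (Trans c) (And (Sub a c) (All y (Imp (Mem y c) (Neg (Mem y y)))))))"

definition IsPot :: "nat \<Rightarrow> nat \<Rightarrow> form" where
  "IsPot s h = (let x = Suc (max s h); c = Suc (Suc (max s h)) in
     All x (Iff (Mem x s) (Ex c (And (Mem c h) (Sub x c)))))"

definition IsPotInter :: "nat \<Rightarrow> nat \<Rightarrow> nat \<Rightarrow> form" where
  "IsPotInter b a h = (let m = Suc (max b (max a h)) in
     All m (Iff (Mem m b) (Ex (Suc m) (And (And (Mem (Suc m) a) (Mem (Suc m) h)) (Sub m (Suc m))))))"

definition History :: "nat \<Rightarrow> form" where
  "History h = (let x = Suc h in All x (Imp (Mem x h) (IsPotInter x x h)))"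

definition Level :: "nat \<Rightarrow> form" where
  "Level s = (let h = Suc s in Ex h (And (History h) (IsPot s h)))"

definition IsBPot :: "nat \<Rightarrow> nat \<Rightarrow> form" where
  "IsBPot s h = (let x = Suc (max s h); c = Suc (Suc (max s h)) in
     All x (Iff (Mem x s) (Ex c (And (Mem c h) (And (Neg (Mem c c)) (Or (Sub x c) (CoSub x c)))))))"

definition IsBPotInter :: "nat \<Rightarrow> nat \<Rightarrow> nat \<Rightarrow> form" where
  "IsBPotInter b a h = (let m = Suc (max b (max a h)) in
     All m (Iff (Mem m b) (Ex (Suc m) (And (And (Mem (Suc m) a) (Mem (Suc m) h))
        (And (Neg (Mem (Suc m) (Suc m))) (Or (Sub m (Suc m)) (CoSub m (Suc m))))))))"

definition BHistory :: "nat \<Rightarrow> form" where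
  "BHistory h = (let x = Suc h in
     And (Neg (Mem h h)) (All x (Imp (Mem x h) (IsBPotInter x x h))))"

definition BLevel :: "nat \<Rightarrow> form" where
  "BLevel s = (let h = Suc s in Ex h (And (BHistory h) (IsBPot s h)))"

definition FunctionalOn :: "rvar \<Rightarrow> nat \<Rightarrow> form" where
  "FunctionalOn R a = (let x = Suc a; y = Suc (Suc a); z = Suc (Suc (Suc a)) in
     All x (Imp (Mem x a) (Ex y (And (Rel R [x, y]) (All z (Imp (Rel R [x, z]) (Eq z y)))))))"

definition ax_Ext :: form where
  "ax_Ext = All 0 (All 1 (Imp (All 2 (Iff (Mem 2 0) (Mem 2 1))) (Eq 0 1)))"

definition ax_Sep :: form where
  "ax_Sep = AllR (0,1) (All 0 (Ex 1 (All 2 (Iff (Mem 2 1) (And (Rel (0,1) [2]) (Mem 2 0))))))"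

definition ax_Strat :: form where
  "ax_Strat = All 0 (Ex 1 (And (Level 1) (Sub 0 1)))"

definition ax_Endless :: form where
  "ax_Endless = All 0 (Imp (Level 0) (Ex 1 (And (Level 1) (Mem 0 1))))"

definition LT :: "form set" where "LT = {ax_Ext, ax_Sep, ax_Strat}"
definition LTplus :: "form set" where "LTplus = insert ax_Endless LT"

definition ax_Compl :: form where
  "ax_Compl = All 0 (Ex 1 (And (IsCompl 1 0) (Iff (Neg (Mem 0 0)) (Mem 1 1))))"

definition ax_SepN :: form where
  "ax_SepN = AllR (0,1) (All 0 (Imp (Neg (Mem 0 0))
     (Ex 1 (And (Neg (Mem 1 1)) (All 2 (Iff (Mem 2 1) (And (Rel (0,1) [2]) (Mem 2 0))))))))"

definition ax_StratN :: form where
  "ax_StratN = All 0 (Imp (Neg (Mem 0 0)) (Ex 1 (And (BLevel 1) (Sub 0 1))))"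

definition ax_EndlessN :: form where
  "ax_EndlessN = All 0 (Imp (BLevel 0) (Ex 1 (And (BLevel 1) (Mem 0 1))))"

definition ax_InfinityN :: form where
  "ax_InfinityN = Ex 0 (And (BLevel 0) (And (Ex 1 (And (BLevel 1) (Mem 1 0)))
     (All 1 (Imp (And (BLevel 1) (Mem 1 0)) (Ex 2 (And (BLevel 2) (And (Mem 1 2) (Mem 2 0))))))))"

definition ax_UnboundedN :: form where
  "ax_UnboundedN = AllR (0,2) (All 0 (Imp (And (Neg (Mem 0 0)) (FunctionalOn (0,2) 0))
     (Ex 1 (And (BLevel 1) (All 2 (Imp (Mem 2 0) (All 3 (Imp (Rel (0,2) [2,3]) (Mem 3 1)))))))))"

definition BLT :: "form set" where "BLT = {ax_Ext, ax_Compl, ax_SepN, ax_StratN}"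
definition BLTplus :: "form set" where "BLTplus = insert ax_EndlessN BLT"
definition BLT_ZF :: "form set" where "BLT_ZF = BLT \<union> {ax_InfinityN, ax_UnboundedN}"

text \<open>ZF, formulated in the same second-order logic (Separation and Replacement as
single second-order axioms).\<close>

definition ax_Found :: form where
  "ax_Found = All 0 (Imp (Ex 1 (Mem 1 0)) (Ex 1 (And (Mem 1 0) (All 2 (Imp (Mem 2 1) (Neg (Mem 2 0)))))))"
definition ax_Pair :: form where
  "ax_Pair = All 0 (All 1 (Ex 2 (All 3 (Iff (Mem 3 2) (Or (Eq 3 0) (Eq 3 1))))))"
definition ax_Union :: form where
  "ax_Union = All 0 (Ex 1 (All 2 (Iff (Mem 2 1) (Ex 3 (And (Mem 3 0) (Mem 2 3))))))"
definition ax_Power :: form where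
  "ax_Power = All 0 (Ex 1 (All 2 (Iff (Mem 2 1) (Sub 2 0))))"
definition ax_Inf :: form where
  "ax_Inf = Ex 0 (And (Ex 1 (And (Mem 1 0) (All 2 (Neg (Mem 2 1)))))
     (All 1 (Imp (Mem 1 0) (Ex 2 (And (Mem 2 0) (All 3 (Iff (Mem 3 2) (Or (Mem 3 1) (Eq 3 1)))))))))"
definition ax_Repl :: form where
  "ax_Repl = AllR (0,2) (All 0 (Imp (FunctionalOn (0,2) 0)
     (Ex 1 (All 3 (Iff (Mem 3 1) (Ex 2 (And (Mem 2 0) (Rel (0,2) [2,3]))))))))"

definition ZF :: "form set" where
  "ZF = {ax_Ext, ax_Found, ax_Pair, ax_Union, ax_Power, ax_Inf, ax_Sep, ax_Repl}"

fun relh :: "form \<Rightarrow> form" where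
  "relh (Imp p q) = Imp (relh p) (relh q)"
| "relh (All x p) = All x (Imp (Helow x) (relh p))"
| "relh (AllR r p) = AllR r (relh p)"
| "relh p = p"

end

theory Submission
  imports Defs "HOL-Library.Countable" "HOL-Library.Infinite_Set"
begin

text \<open>By Henkin completeness, if \<open>\<phi>\<^sup>h\<close> is not derivable from the boolean theory, it fails in some
  Henkin structure \<open>M\<close> satisfying that theory. Restricting the first-order domain of \<open>M\<close> to the helow
  sets, while keeping the relations, gives a Henkin structure in which \<open>\<phi>\<close> fails; so, by soundness, it
  remains to see that this structure satisfies the axioms of the ordinary theory.

  Helow sets are low and closed under members and subsets. Low potent sets are well-founded by
  Scott's argument, whence the low members of a boolean-history are transitive and are
  boolean-levels, and boolean-levels are low. The helow part of a boolean-level \<open>s\<close> is a level of the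
  restricted structure: its history consists of the helow parts of the boolean-levels in \<open>s\<close>.\<close>

section \<open>Henkin semantics and soundness\<close>

text \<open>A set is low if it is not a member of itself, and high otherwise. The calculus governs
  relation quantifiers only by instantiation, generalization and comprehension, so its complete
  semantics lets them range over a family \<open>Q\<close> that is merely closed under definability.
  Hence each class used for Separation or for choosing a minimal element has to be exhibited as a
  \<open>form\<close> with parameters. What links boolean and ordinary notions is that complements
  of low sets are high while subsets of low sets are low. So for low \<open>x\<close> and low
  \<open>c\<close> the complement of \<open>x\<close> is never included in \<open>c\<close>, and on
  low sets bpot acts as pot.\<close>

fun sat :: "'a set \<Rightarrow> ('a \<Rightarrow> 'a \<Rightarrow> bool) \<Rightarrow> (nat \<Rightarrow> ('a list \<Rightarrow> bool) set) \<Rightarrow>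
    (nat \<Rightarrow> 'a) \<Rightarrow> (rvar \<Rightarrow> 'a list \<Rightarrow> bool) \<Rightarrow> form \<Rightarrow> bool" where
  "sat U E Q e r (Mem a b) = E (e a) (e b)"
| "sat U E Q e r (Eq a b) = (e a = e b)"
| "sat U E Q e r (Rel R xs) = r R (map e xs)"
| "sat U E Q e r Bot = False"
| "sat U E Q e r (Imp p q) = (sat U E Q e r p \<longrightarrow> sat U E Q e r q)"
| "sat U E Q e r (All x p) = (\<forall>d\<in>U. sat U E Q (e(x := d)) r p)"
| "sat U E Q e r (AllR R p) = (\<forall>X\<in>Q (snd R). sat U E Q e (r(R := X)) p)"

lemma sat_connectives [simp]:
  "sat U E Q e r (Neg p) = (\<not> sat U E Q e r p)"
  "sat U E Q e r (Or p q) = (sat U E Q e r p \<or> sat U E Q e r q)"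
  "sat U E Q e r (And p q) = (sat U E Q e r p \<and> sat U E Q e r q)"
  "sat U E Q e r (Iff p q) = (sat U E Q e r p \<longleftrightarrow> sat U E Q e r q)"
  "sat U E Q e r (Ex x p) = (\<exists>d\<in>U. sat U E Q (e(x := d)) r p)"
  "sat U E Q e r (ExR R p) = (\<exists>X\<in>Q (snd R). sat U E Q e (r(R := X)) p)"
  by (auto simp: Neg_def Or_def And_def Iff_def Ex_def ExR_def)

lemma connective_variables [simp]:
  "fv (Neg p) = fv p" "frv (Neg p) = frv p" "wf (Neg p) = wf p"
  "fv (Or p q) = fv p \<union> fv q" "frv (Or p q) = frv p \<union> frv q" "wf (Or p q) = (wf p \<and> wf q)"
  "fv (And p q) = fv p \<union> fv q" "frv (And p q) = frv p \<union> frv q" "wf (And p q) = (wf p \<and> wf q)"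
  "fv (Iff p q) = fv p \<union> fv q" "frv (Iff p q) = frv p \<union> frv q" "wf (Iff p q) = (wf p \<and> wf q)"
  "fv (Ex x p) = fv p - {x}" "frv (Ex x p) = frv p" "wf (Ex x p) = wf p"
  "fv (ExR R p) = fv p" "frv (ExR R p) = frv p - {R}" "wf (ExR R p) = wf p"
  by (auto simp: Neg_def Or_def And_def Iff_def Ex_def ExR_def)

lemma sat_cong:
  "\<lbrakk>\<And>x. x \<in> fv p \<Longrightarrow> e x = e' x; \<And>R. R \<in> frv p \<Longrightarrow> r R = r' R\<rbrakk>
    \<Longrightarrow> sat U E Q e r p = sat U E Q e' r' p"
proof (induction p arbitrary: e e' r r')
  case (Rel R xs)
  then have "map e xs = map e' xs" "r R = r' R" by auto
  then show ?case by (simp only: sat.simps)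
next
  case (Imp p q)
  have "sat U E Q e r p = sat U E Q e' r' p" "sat U E Q e r q = sat U E Q e' r' q"
    using Imp.prems by (auto intro!: Imp.IH)
  then show ?case by simp
next
  case (All x p)
  have "sat U E Q (e(x := d)) r p = sat U E Q (e'(x := d)) r' p" for d
    using All.prems by (auto intro!: All.IH)
  then show ?case by simp
next
  case (AllR R p)
  have "sat U E Q e (r(R := X)) p = sat U E Q e' (r'(R := X)) p" for X
    using AllR.prems by (auto intro!: AllR.IH)
  then show ?case by simp
qed auto

lemma sat_upd_notin_fv: "x \<notin> fv p \<Longrightarrow> sat U E Q (e(x := d)) r p = sat U E Q e r p"
  by (rule sat_cong) auto

lemma sat_upd_notin_frv: "R \<notin> frv p \<Longrightarrow> sat U E Q e (r(R := X)) p = sat U E Q e r p"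
  by (rule sat_cong) auto

lemma subst_notin_fv: "x \<notin> fv p \<Longrightarrow> subst x y p = p"
  by (induction p) (auto simp: sv_def intro: map_idI)

lemma rsubst_notin_frv: "R \<notin> frv p \<Longrightarrow> rsubst R S p = p"
  by (induction p) auto

lemma sat_subst:
  "free_for y x p \<Longrightarrow> sat U E Q e r (subst x y p) = sat U E Q (e(x := e y)) r p"
proof (induction p arbitrary: e r)
  case (Rel R xs)
  have "map e (map (sv x y) xs) = map (e(x := e y)) xs" by (auto simp: sv_def)
  then show ?case by (simp only: sat.simps subst.simps)
next
  case (All z p)
  show ?case
  proof (cases "z = x \<or> x \<notin> fv p")
    case True
    then have "subst x y (All z p) = All z p" by (auto simp: subst_notin_fv)
    moreover have "x \<notin> fv (All z p)" using True by auto
    ultimately show ?thesis by (metis sat_upd_notin_fv)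
  next
    case False
    with All have "free_for y x p" "z \<noteq> y" "z \<noteq> x" by auto
    then have "sat U E Q (e(z := d)) r (subst x y p) = sat U E Q (e(x := e y, z := d)) r p" for d
      using All.IH[of "e(z := d)" r] by (metis fun_upd_other fun_upd_twist)
    then show ?thesis using \<open>z \<noteq> x\<close> by (simp del: fun_upd_apply)
  qed
qed (auto simp: sv_def)

lemma sat_rsubst:
  "rfree_for S R p \<Longrightarrow> sat U E Q e r (rsubst R S p) = sat U E Q e (r(R := r S)) p"
proof (induction p arbitrary: e r)
  case (AllR T p)
  show ?case
  proof (cases "T = R \<or> R \<notin> frv p")
    case True
    then have "rsubst R S (AllR T p) = AllR T p" by (auto simp: rsubst_notin_frv)
    moreover have "R \<notin> frv (AllR T p)" using True by auto
    ultimately show ?thesis by (metis sat_upd_notin_frv)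
  next
    case False
    with AllR have "rfree_for S R p" "T \<noteq> S" "T \<noteq> R" by auto
    then have "sat U E Q e (r(T := X)) (rsubst R S p) = sat U E Q e (r(R := r S, T := X)) p" for X
      using AllR.IH[of e "r(T := X)"] by (metis fun_upd_other fun_upd_twist)
    then show ?thesis using \<open>T \<noteq> R\<close> by (simp del: fun_upd_apply)
  qed
qed auto

definition valid :: "'a set \<Rightarrow> ('a \<Rightarrow> 'a \<Rightarrow> bool) \<Rightarrow> (nat \<Rightarrow> ('a list \<Rightarrow> bool) set) \<Rightarrow> form \<Rightarrow> bool" where
  "valid U E Q p \<longleftrightarrow> (\<forall>e r. (\<forall>x. e x \<in> U) \<longrightarrow> (\<forall>R. r R \<in> Q (snd R)) \<longrightarrow> sat U E Q e r p)"

lemma validD: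
  "valid U E Q p \<Longrightarrow> \<forall>x. e x \<in> U \<Longrightarrow> \<forall>R. r R \<in> Q (snd R) \<Longrightarrow> sat U E Q e r p"
  unfolding valid_def by blast

definition henkin :: "'a set \<Rightarrow> ('a \<Rightarrow> 'a \<Rightarrow> bool) \<Rightarrow> (nat \<Rightarrow> ('a list \<Rightarrow> bool) set) \<Rightarrow> bool" where
  "henkin U E Q \<longleftrightarrow> (\<forall>p R vs. wf p \<longrightarrow> R \<notin> frv p \<longrightarrow> distinct vs \<longrightarrow> length vs = snd R \<longrightarrow>
     valid U E Q (ExR R (alls vs (Iff (Rel R vs) p))))"

lemma henkinD:
  "\<lbrakk>henkin U E Q; wf p; R \<notin> frv p; distinct vs; length vs = snd R\<rbrakk>
    \<Longrightarrow> valid U E Q (ExR R (alls vs (Iff (Rel R vs) p)))"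
  unfolding henkin_def by blast

lemma logax_valid: "logax p \<Longrightarrow> henkin U E Q \<Longrightarrow> valid U E Q p"
proof (induction rule: logax.induct)
  case (dist x p q)
  then show ?case by (auto simp: valid_def sat_upd_notin_fv)
next
  case (distR R p q)
  then show ?case by (auto simp: valid_def sat_upd_notin_frv)
next
  case (instR S R p)
  show ?case
    unfolding valid_def
  proof (intro allI impI)
    fix e :: "nat \<Rightarrow> 'a" and r :: "rvar \<Rightarrow> 'a list \<Rightarrow> bool"
    assume "\<forall>x. e x \<in> U" "\<forall>R. r R \<in> Q (snd R)"
    then have "r S \<in> Q (snd R)" using instR(1) by metis
    then show "sat U E Q e r (Imp (AllR R p) (rsubst R S p))"
      using instR(2) by (simp add: sat_rsubst)
  qed
next
  case (compr p R vs)
  then show ?case by (intro henkinD)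
qed (auto simp: valid_def sat_subst)

theorem deriv_valid:
  "T \<turnstile> p \<Longrightarrow> henkin U E Q \<Longrightarrow> \<forall>q\<in>T. valid U E Q q \<Longrightarrow> valid U E Q p"
proof (induction rule: deriv.induct)
  case (log p T)
  then show ?case using logax_valid by blast
qed (auto simp: valid_def)

section \<open>Completeness\<close>

fun bv :: "form \<Rightarrow> nat set" where
  "bv (Imp p q) = bv p \<union> bv q"
| "bv (All x p) = insert x (bv p)"
| "bv (AllR R p) = bv p"
| "bv _ = {}"

fun brv :: "form \<Rightarrow> rvar set" where
  "brv (Imp p q) = brv p \<union> brv q"
| "brv (All x p) = brv p"
| "brv (AllR R p) = insert R (brv p)"
| "brv _ = {}"

text \<open>The truth lemma recurses on substitution instances, which are not subformulas, so it
  needs a measure that substitution leaves unchanged.\<close>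

fun fsize :: "form \<Rightarrow> nat" where
  "fsize (Imp p q) = Suc (fsize p + fsize q)"
| "fsize (All x p) = Suc (fsize p)"
| "fsize (AllR R p) = Suc (fsize p)"
| "fsize _ = 0"

lemma finite_variables [simp]: "finite (fv p)" "finite (bv p)" "finite (frv p)" "finite (brv p)"
  by (induction p) auto

lemma subst_invariants [simp]:
  "bv (subst x y p) = bv p" "brv (subst x y p) = brv p" "fsize (subst x y p) = fsize p"
  by (induction p) auto

lemma rsubst_invariants [simp]:
  "bv (rsubst R S p) = bv p" "brv (rsubst R S p) = brv p" "fsize (rsubst R S p) = fsize p"
  by (induction p) auto

lemma free_for_notin_bv: "y \<notin> bv p \<Longrightarrow> free_for y x p"
  by (induction p) auto

lemma rfree_for_notin_brv: "S \<notin> brv p \<Longrightarrow> rfree_for S R p"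
  by (induction p) auto

text \<open>Renaming forth and back trades a generalization over a fresh \<open>w\<close> for one
  over \<open>x\<close>; the calculus has no rule for changing bound variables.\<close>

lemma subst_fresh_inverse: "w \<notin> fv p \<union> bv p \<Longrightarrow> subst w x (subst x w p) = p"
proof (induction p)
  case (Rel R xs)
  then have "sv w x (sv x w v) = v" if "v \<in> set xs" for v using that by (auto simp: sv_def)
  then show ?case by (simp add: map_idI)
qed (auto simp: sv_def subst_notin_fv)

lemma free_for_fresh_inverse: "w \<notin> fv p \<union> bv p \<Longrightarrow> free_for x w (subst x w p)"
  by (induction p) auto

lemma notin_fv_subst: "x \<noteq> w \<Longrightarrow> x \<notin> fv (subst x w p)"
  by (induction p) (auto simp: sv_def split: if_splits)

lemma rsubst_fresh_inverse: "S \<notin> frv p \<union> brv p \<Longrightarrow> rsubst S R (rsubst R S p) = p"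
  by (induction p) (auto simp: rsubst_notin_frv)

lemma rfree_for_fresh_inverse: "S \<notin> frv p \<union> brv p \<Longrightarrow> rfree_for R S (rsubst R S p)"
  by (induction p) auto

lemma notin_frv_rsubst: "R \<noteq> S \<Longrightarrow> R \<notin> frv (rsubst R S p)"
  by (induction p) auto

text \<open>\<open>gen\<close> and \<open>genR\<close> apply to consequences of \<open>T\<close>
  without restriction, so an open formula put into \<open>T\<close> would assert its universal
  closure. Temporary hypotheses are therefore carried as antecedents. With the head as the innermost
  antecedent, the deduction theorem holds by definition.\<close>

fun imps :: "form list \<Rightarrow> form \<Rightarrow> form" where
  "imps [] p = p"
| "imps (a # G) p = imps G (Imp a p)"

lemma imps_theorem: "T \<turnstile> p \<Longrightarrow> T \<turnstile> imps G p"
proof (induction G arbitrary: p)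
  case (Cons a G)
  then have "T \<turnstile> Imp a p" using deriv.mp deriv.log logax.ax1 by blast
  then show ?case using Cons.IH by simp
qed simp

lemma imps_mp: "T \<turnstile> imps G (Imp p q) \<Longrightarrow> T \<turnstile> imps G p \<Longrightarrow> T \<turnstile> imps G q"
proof (induction G arbitrary: p q)
  case Nil
  then show ?case by (auto intro: deriv.mp)
next
  case (Cons a G)
  have "T \<turnstile> imps G (Imp (Imp a (Imp p q)) (Imp (Imp a p) (Imp a q)))"
    by (intro imps_theorem deriv.log logax.ax2)
  then show ?case using Cons by simp blast
qed

lemma imps_logax: "logax p \<Longrightarrow> T \<turnstile> imps G p"
  by (intro imps_theorem deriv.log)

lemma imps_weaken: "T \<turnstile> imps G p \<Longrightarrow> T \<turnstile> imps (a # G) p"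
  using imps_mp[OF imps_logax[OF logax.ax1]] by simp

lemma imps_hyp: "T \<turnstile> imps (a # G) a"
proof -
  have "T \<turnstile> imps G (Imp (Imp a (Imp (Imp a a) a)) (Imp (Imp a (Imp a a)) (Imp a a)))"
    by (rule imps_logax) (rule logax.ax2)
  then show ?thesis using imps_mp imps_logax logax.ax1 by simp metis
qed

lemma imps_contradiction:
  assumes "T \<turnstile> imps G p" "T \<turnstile> imps G (Neg p)"
  shows "T \<turnstile> imps G q"
proof -
  have "T \<turnstile> imps G Bot" using imps_mp assms unfolding Neg_def by blast
  then have "T \<turnstile> imps G (Neg (Neg q))"
    using imps_mp[OF imps_logax[OF logax.ax1]] unfolding Neg_def by blast
  then show ?thesis using imps_mp[OF imps_logax[OF logax.ax3]] by blast
qed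

lemma imps_gen: "T \<turnstile> imps G p \<Longrightarrow> x \<notin> \<Union> (fv ` set G) \<Longrightarrow> T \<turnstile> imps G (All x p)"
proof (induction G arbitrary: p)
  case Nil
  then show ?case by (auto intro: deriv.gen)
next
  case (Cons a G)
  then have "T \<turnstile> imps G (All x (Imp a p))" by auto
  moreover have "T \<turnstile> imps G (Imp (All x (Imp a p)) (Imp a (All x p)))"
    using Cons.prems by (intro imps_logax logax.dist) auto
  ultimately show ?case using imps_mp by auto
qed

lemma imps_genR: "T \<turnstile> imps G p \<Longrightarrow> R \<notin> \<Union> (frv ` set G) \<Longrightarrow> T \<turnstile> imps G (AllR R p)"
proof (induction G arbitrary: p)
  case Nil
  then show ?case by (auto intro: deriv.genR)
next
  case (Cons a G)
  then have "T \<turnstile> imps G (AllR R (Imp a p))" by auto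
  moreover have "T \<turnstile> imps G (Imp (AllR R (Imp a p)) (Imp a (AllR R p)))"
    using Cons.prems by (intro imps_logax logax.distR) auto
  ultimately show ?case using imps_mp by auto
qed

text \<open>The eigenvariable rule: generalize over \<open>w\<close> under the antecedents,
  instantiate back to \<open>x\<close>, and generalize over \<open>x\<close>, which is no longer
  free in the formula quantified over \<open>w\<close>.\<close>

lemma imps_generalize_fresh:
  assumes "T \<turnstile> imps G (subst x w p)" and w: "w \<notin> \<Union> (fv ` set G)" "w \<notin> fv p \<union> bv p" "w \<noteq> x"
  shows "T \<turnstile> imps G (All x p)"
proof -
  let ?A = "All w (subst x w p)"
  have "T \<turnstile> Imp ?A p"
    using deriv.log[OF logax.inst[OF free_for_fresh_inverse[OF w(2)]]] subst_fresh_inverse[OF w(2)]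
    by metis
  then have "T \<turnstile> Imp ?A (All x p)"
    using deriv.mp[OF deriv.log[OF logax.dist] deriv.gen] w notin_fv_subst[of x w p] by auto
  then show ?thesis using imps_mp imps_theorem imps_gen[OF assms(1) w(1)] by blast
qed

lemma imps_generalizeR_fresh:
  assumes "T \<turnstile> imps G (rsubst R S p)" and "snd S = snd R"
    and S: "S \<notin> \<Union> (frv ` set G)" "S \<notin> frv p \<union> brv p" "S \<noteq> R"
  shows "T \<turnstile> imps G (AllR R p)"
proof -
  let ?A = "AllR S (rsubst R S p)"
  have "T \<turnstile> Imp ?A p"
    using deriv.log[OF logax.instR[OF assms(2)[symmetric] rfree_for_fresh_inverse[OF S(2)]]]
      rsubst_fresh_inverse[OF S(2)] by metis
  then have "T \<turnstile> Imp ?A (AllR R p)"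
    using deriv.mp[OF deriv.log[OF logax.distR] deriv.genR] S notin_frv_rsubst[of R S p] by auto
  then show ?thesis using imps_mp imps_theorem imps_genR[OF assms(1) S(1)] by blast
qed

section \<open>The Henkin extension step\<close>

instance form :: countable
  by countable_datatype

text \<open>Deciding \<open>p\<close> and refuting an instance of an unproved universal
  \<open>p\<close> happen at one stage, so a single enumeration of the formulas yields a set both
  complete and witnessed. A relation witness keeps the arity of \<open>R\<close> and takes only its
  index from \<open>W\<close>.\<close>

definition extends :: "form set \<Rightarrow> nat set \<Rightarrow> form \<Rightarrow> form list \<Rightarrow> form list \<Rightarrow> bool" where
  "extends T W p G H \<longleftrightarrow> \<not> T \<turnstile> imps H Bot \<and> (\<forall>q. T \<turnstile> imps G q \<longrightarrow> T \<turnstile> imps H q) \<and>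
     (T \<turnstile> imps H p \<or> T \<turnstile> imps H (Neg p)) \<and>
     (\<forall>x q. p = All x q \<longrightarrow> \<not> T \<turnstile> imps H p \<longrightarrow> (\<exists>w\<in>W. T \<turnstile> imps H (Neg (subst x w q)))) \<and>
     (\<forall>R q. p = AllR R q \<longrightarrow> \<not> T \<turnstile> imps H p \<longrightarrow> (\<exists>i\<in>W. T \<turnstile> imps H (Neg (rsubst R (i, snd R) q))))"

text \<open>If \<open>p\<close> is consistent with \<open>G\<close>, adding it suffices, since the
  witness clauses become vacuous. Otherwise \<open>G\<close> refutes \<open>p\<close>, and a
  universal \<open>p\<close> has an unprovable instance at any variable fresh for \<open>G\<close>
  and \<open>p\<close>; the infinite \<open>W\<close> contains one, and adding the negated instance
  preserves consistency.\<close>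

lemma extends_exists:
  assumes "infinite W" and con: "\<not> T \<turnstile> imps G Bot"
  shows "\<exists>H. extends T W p G H"
proof (cases "T \<turnstile> imps (p # G) Bot")
  case False
  have "extends T W p G (p # G)"
    using False imps_hyp imps_weaken unfolding extends_def by blast
  then show ?thesis by blast
next
  case True
  then have neg: "T \<turnstile> imps G (Neg p)" by (simp add: Neg_def)
  have add: "\<not> T \<turnstile> imps (Neg q # G) Bot" if "\<not> T \<turnstile> imps G q" for q
  proof
    assume "T \<turnstile> imps (Neg q # G) Bot"
    then have "T \<turnstile> imps G (Neg (Neg q))" by (simp add: Neg_def)
    then show False using that imps_mp[OF imps_logax[OF logax.ax3]] by blast
  qed
  have nothm: "\<not> T \<turnstile> imps G p" using con neg imps_contradiction by blast
  show ?thesis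
  proof (cases p)
    case p: (All x q)
    have "finite (insert x (\<Union> (fv ` set G) \<union> (fv q \<union> bv q)))" by auto
    then obtain w where w: "w \<in> W" "w \<notin> insert x (\<Union> (fv ` set G) \<union> (fv q \<union> bv q))"
      using \<open>infinite W\<close> by (meson finite_subset subsetI)
    have "\<not> T \<turnstile> imps G (subst x w q)" using w nothm p imps_generalize_fresh[of T G x w q] by auto
    then have "extends T W p G (Neg (subst x w q) # G)"
      using add w(1) p imps_hyp imps_weaken neg unfolding extends_def by blast
    then show ?thesis by blast
  next
    case p: (AllR R q)
    have "finite (fst ` (insert R (\<Union> (frv ` set G) \<union> (frv q \<union> brv q))))" by auto
    then obtain i where i: "i \<in> W" "i \<notin> fst ` (insert R (\<Union> (frv ` set G) \<union> (frv q \<union> brv q)))"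
      using \<open>infinite W\<close> by (meson finite_subset subsetI)
    then have "(i, snd R) \<notin> insert R (\<Union> (frv ` set G) \<union> (frv q \<union> brv q))"
      by (metis fst_conv image_eqI)
    then have "\<not> T \<turnstile> imps G (rsubst R (i, snd R) q)"
      using nothm p imps_generalizeR_fresh[of T G R "(i, snd R)" q] by auto
    then have "extends T W p G (Neg (rsubst R (i, snd R) q) # G)"
      using add i(1) p imps_hyp imps_weaken neg unfolding extends_def by blast
    then show ?thesis by blast
  qed (use con neg in \<open>auto simp: extends_def\<close>)
qed

section \<open>Universal closures and injective renaming\<close>

fun allRs :: "rvar list \<Rightarrow> form \<Rightarrow> form" where
  "allRs [] p = p"
| "allRs (R # Rs) p = AllR R (allRs Rs p)"

lemma alls_simps [simp]:
  "fv (alls xs p) = fv p - set xs" "frv (alls xs p) = frv p"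
  "bv (alls xs p) = set xs \<union> bv p" "brv (alls xs p) = brv p"
  by (induction xs) auto

lemma allRs_simps [simp]:
  "fv (allRs Rs p) = fv p" "frv (allRs Rs p) = frv p - set Rs"
  "bv (allRs Rs p) = bv p" "brv (allRs Rs p) = set Rs \<union> brv p"
  by (induction Rs) auto

lemma deriv_alls: "T \<turnstile> p \<Longrightarrow> T \<turnstile> alls xs p"
  by (induction xs) (auto intro: deriv.gen)

lemma deriv_allRs: "T \<turnstile> p \<Longrightarrow> T \<turnstile> allRs Rs p"
  by (induction Rs) (auto intro: deriv.genR)

lemma sat_allsD: "sat U E Q e r (alls xs p) \<Longrightarrow> \<forall>x. e x \<in> U \<Longrightarrow> sat U E Q e r p"
proof (induction xs)
  case (Cons x xs)
  then have "sat U E Q (e(x := e x)) r (alls xs p)" by (simp del: fun_upd_triv)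
  then show ?case using Cons by simp
qed simp

lemma sat_allRsD: "sat U E Q e r (allRs Rs p) \<Longrightarrow> \<forall>R. r R \<in> Q (snd R) \<Longrightarrow> sat U E Q e r p"
proof (induction Rs)
  case (Cons R Rs)
  then have "r R \<in> Q (snd R)" by metis
  then have "sat U E Q e (r(R := r R)) (allRs Rs p)" using Cons.prems(1) by (simp del: fun_upd_triv)
  then show ?case using Cons by simp
qed simp

definition rren :: "(nat \<Rightarrow> nat) \<Rightarrow> rvar \<Rightarrow> rvar" where
  "rren f R = (f (fst R), snd R)"

lemma rren_simps [simp]: "fst (rren f R) = f (fst R)" "snd (rren f R) = snd R"
  by (auto simp: rren_def)

lemma inj_rren: "inj f \<Longrightarrow> inj (rren f)"
  by (auto simp: rren_def inj_def prod_eq_iff)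

fun ren :: "(nat \<Rightarrow> nat) \<Rightarrow> form \<Rightarrow> form" where
  "ren f (Mem a b) = Mem (f a) (f b)"
| "ren f (Eq a b) = Eq (f a) (f b)"
| "ren f (Rel R xs) = Rel (rren f R) (map f xs)"
| "ren f Bot = Bot"
| "ren f (Imp p q) = Imp (ren f p) (ren f q)"
| "ren f (All x p) = All (f x) (ren f p)"
| "ren f (AllR R p) = AllR (rren f R) (ren f p)"

lemma ren_connectives [simp]:
  "ren f (Neg p) = Neg (ren f p)" "ren f (And p q) = And (ren f p) (ren f q)"
  "ren f (Iff p q) = Iff (ren f p) (ren f q)" "ren f (ExR R p) = ExR (rren f R) (ren f p)"
  "ren f (alls xs p) = alls (map f xs) (ren f p)"
  by (auto simp: Neg_def And_def Iff_def ExR_def) (induction xs, auto)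

lemma ren_variables:
  "fv (ren f p) \<subseteq> range f" "bv (ren f p) \<subseteq> range f"
  "fst ` frv (ren f p) \<subseteq> range f" "fst ` brv (ren f p) \<subseteq> range f"
  by (induction p) auto

lemma wf_ren [simp]: "wf (ren f p) = wf p"
  by (induction p) auto

lemma frv_ren: "inj f \<Longrightarrow> frv (ren f p) = rren f ` frv p"
  by (induction p) (use inj_rren[of f] in \<open>auto simp: inj_eq\<close>)

lemma sat_ren:
  assumes "inj f"
  shows "sat U E Q e r (ren f p) = sat U E Q (\<lambda>x. e (f x)) (\<lambda>R. r (rren f R)) p"
proof (induction p arbitrary: e r)
  case (Rel R xs)
  then show ?case by (simp add: comp_def)
next
  case (All x p)
  have "(\<lambda>y. (e(f x := d)) (f y)) = (\<lambda>y. e (f y))(x := d)" for d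
    using assms by (auto simp: inj_eq)
  then show ?case using All by (simp del: fun_upd_apply)
next
  case (AllR R p)
  have "inj (rren f)" using assms by (rule inj_rren)
  then have "(\<lambda>S. (r(rren f R := X)) (rren f S)) = (\<lambda>S. r (rren f S))(R := X)" for X
    by (auto simp: inj_eq)
  moreover have "snd (rren f R) = snd R" by simp
  ultimately show ?case using AllR by (simp del: fun_upd_apply)
qed auto

text \<open>The language has no constants, so the variables (and indices of relation variables) in \<open>W\<close>
  serve as Henkin witnesses; they can be substituted without capture into formulas whose bound
  variables avoid \<open>W\<close>.\<close>

locale henkin_construction =
  fixes T :: "form set" and W :: "nat set" and G0 :: "form list"
  assumes inf: "infinite W" and coinf: "infinite (- W)"
    and consistent: "\<not> T \<turnstile> imps G0 Bot"
begin

primrec stage :: "nat \<Rightarrow> form list" where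
  "stage 0 = G0"
| "stage (Suc n) = (SOME H. extends T W (from_nat n) (stage n) H)"

definition \<Gamma> :: "form set" where "\<Gamma> = {p. \<exists>n. T \<turnstile> imps (stage n) p}"

lemma stage_consistent: "\<not> T \<turnstile> imps (stage n) Bot"
  and stage_extends: "extends T W (from_nat n) (stage n) (stage (Suc n))"
proof -
  have ext: "extends T W (from_nat n) (stage n) (stage (Suc n))" if "\<not> T \<turnstile> imps (stage n) Bot" for n
    using someI_ex[OF extends_exists[OF inf that]] by simp
  show con: "\<not> T \<turnstile> imps (stage n) Bot" for n
  proof (induction n)
    case (Suc n)
    then show ?case using ext unfolding extends_def by blast
  qed (simp add: consistent)
  show "extends T W (from_nat n) (stage n) (stage (Suc n))" using ext con .
qed

lemma stage_to_nat: "extends T W p (stage (to_nat p)) (stage (Suc (to_nat p)))"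
  using stage_extends[of "to_nat p"] by (simp only: from_nat_to_nat)

lemma stage_mono: "m \<le> n \<Longrightarrow> T \<turnstile> imps (stage m) p \<Longrightarrow> T \<turnstile> imps (stage n) p"
proof (induction n rule: dec_induct)
  case (step n)
  then show ?case using stage_extends[of n] unfolding extends_def by blast
qed

lemma \<Gamma>_theorem: "T \<turnstile> p \<Longrightarrow> p \<in> \<Gamma>"
  unfolding \<Gamma>_def using imps_theorem by blast

lemma \<Gamma>_mp:
  assumes "Imp p q \<in> \<Gamma>" "p \<in> \<Gamma>"
  shows "q \<in> \<Gamma>"
proof -
  from assms obtain m n where "T \<turnstile> imps (stage m) (Imp p q)" "T \<turnstile> imps (stage n) p"
    unfolding \<Gamma>_def by blast
  then have "T \<turnstile> imps (stage (max m n)) q"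
    using stage_mono[of m "max m n"] stage_mono[of n "max m n"] imps_mp by (meson max.cobounded1 max.cobounded2)
  then show ?thesis unfolding \<Gamma>_def by blast
qed

lemma \<Gamma>_logax: "logax (Imp p q) \<Longrightarrow> p \<in> \<Gamma> \<Longrightarrow> q \<in> \<Gamma>"
  using \<Gamma>_mp \<Gamma>_theorem deriv.log by blast

lemma Bot_notin_\<Gamma>: "Bot \<notin> \<Gamma>"
  using stage_consistent unfolding \<Gamma>_def by blast

lemma in_\<Gamma>I: "T \<turnstile> imps (stage n) p \<Longrightarrow> p \<in> \<Gamma>"
  unfolding \<Gamma>_def by blast

lemma Neg_in_\<Gamma>: "Neg p \<in> \<Gamma> \<longleftrightarrow> p \<notin> \<Gamma>"
proof
  show "Neg p \<in> \<Gamma> \<Longrightarrow> p \<notin> \<Gamma>" using \<Gamma>_mp[of p Bot] Bot_notin_\<Gamma> by (auto simp: Neg_def)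
  have "T \<turnstile> imps (stage (Suc (to_nat p))) p \<or> T \<turnstile> imps (stage (Suc (to_nat p))) (Neg p)"
    using stage_to_nat[of p] unfolding extends_def by (elim conjE)
  then show "p \<notin> \<Gamma> \<Longrightarrow> Neg p \<in> \<Gamma>" using in_\<Gamma>I by blast
qed

lemma Imp_in_\<Gamma>: "Imp p q \<in> \<Gamma> \<longleftrightarrow> (p \<in> \<Gamma> \<longrightarrow> q \<in> \<Gamma>)"
proof -
  have "T \<turnstile> imps [p, Neg p] q"
    by (rule imps_contradiction[OF imps_hyp imps_weaken[OF imps_hyp]])
  then have "Imp p q \<in> \<Gamma>" if "Neg p \<in> \<Gamma>" using \<Gamma>_mp[OF \<Gamma>_theorem that] by simp
  then show ?thesis using \<Gamma>_mp[of p q] \<Gamma>_logax[OF logax.ax1, of q p] Neg_in_\<Gamma>[of p] by blast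
qed

lemma All_witness:
  assumes "All x p \<notin> \<Gamma>"
  shows "\<exists>w\<in>W. subst x w p \<notin> \<Gamma>"
proof -
  let ?H = "stage (Suc (to_nat (All x p)))"
  have "\<not> T \<turnstile> imps ?H (All x p)" using assms in_\<Gamma>I by blast
  then obtain w where "w \<in> W" "T \<turnstile> imps ?H (Neg (subst x w p))"
    using stage_to_nat[of "All x p"] unfolding extends_def by blast
  then show ?thesis using in_\<Gamma>I Neg_in_\<Gamma> by blast
qed

lemma AllR_witness:
  assumes "AllR R p \<notin> \<Gamma>"
  shows "\<exists>i\<in>W. rsubst R (i, snd R) p \<notin> \<Gamma>"
proof -
  let ?H = "stage (Suc (to_nat (AllR R p)))"
  have "\<not> T \<turnstile> imps ?H (AllR R p)" using assms in_\<Gamma>I by blast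
  then obtain i where "i \<in> W" "T \<turnstile> imps ?H (Neg (rsubst R (i, snd R) p))"
    using stage_to_nat[of "AllR R p"] unfolding extends_def by blast
  then show ?thesis using in_\<Gamma>I Neg_in_\<Gamma> by blast
qed

lemma Eq_refl: "Eq x x \<in> \<Gamma>"
  by (intro \<Gamma>_theorem deriv.log logax.refl)

lemma Eq_replace:
  assumes "Eq x y \<in> \<Gamma>" "bv p = {}" "subst z x p \<in> \<Gamma>"
  shows "subst z y p \<in> \<Gamma>"
proof -
  have "Imp (Eq x y) (Imp (subst z x p) (subst z y p)) \<in> \<Gamma>"
    using assms(2) by (intro \<Gamma>_theorem deriv.log logax.leibniz free_for_notin_bv) auto
  then show ?thesis using assms \<Gamma>_mp by blast
qed

text \<open>In this and the next lemmas a successor such as \<open>Suc x\<close> is a placeholder: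
  differing from the other variable of the atom, it marks the one occurrence that Leibniz
  replaces.\<close>

lemma Eq_sym: "Eq x y \<in> \<Gamma> \<Longrightarrow> Eq y x \<in> \<Gamma>"
  using Eq_replace[of x y "Eq (Suc x) x" "Suc x"] Eq_refl by (simp add: sv_def)

lemma Eq_trans: "Eq x y \<in> \<Gamma> \<Longrightarrow> Eq y z \<in> \<Gamma> \<Longrightarrow> Eq x z \<in> \<Gamma>"
  using Eq_replace[of y z "Eq x (Suc x)" "Suc x"] by (simp add: sv_def)

lemma Mem_replace:
  assumes "Eq a a' \<in> \<Gamma>" "Eq b b' \<in> \<Gamma>" "Mem a b \<in> \<Gamma>"
  shows "Mem a' b' \<in> \<Gamma>"
proof -
  have "Mem a' b \<in> \<Gamma>"
    using Eq_replace[of a a' "Mem (Suc b) b" "Suc b"] assms by (simp add: sv_def)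
  then show ?thesis
    using Eq_replace[of b b' "Mem a' (Suc a')" "Suc a'"] assms by (simp add: sv_def)
qed

text \<open>\<open>ys\<close> holds the arguments already replaced. Generalizing over it lets the
  induction change one position at a time, through a fresh placeholder \<open>z\<close>.\<close>

lemma Rel_replace:
  "\<forall>x. Eq x (f x) \<in> \<Gamma> \<Longrightarrow> Rel R (map f ys @ xs) \<in> \<Gamma> \<longleftrightarrow> Rel R (map f (ys @ xs)) \<in> \<Gamma>"
proof (induction xs arbitrary: ys)
  case (Cons x xs)
  obtain z where z: "z \<notin> set (map f ys @ x # xs)"
    using ex_new_if_finite[OF infinite_UNIV_nat] by blast
  have s: "subst z v (Rel R (map f ys @ z # xs)) = Rel R (map f ys @ v # xs)" for v
    using z by (auto simp: sv_def map_idI intro!: map_idI)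
  have "Rel R (map f ys @ x # xs) \<in> \<Gamma> \<longleftrightarrow> Rel R (map f ys @ f x # xs) \<in> \<Gamma>"
    using Eq_replace[of x "f x" "Rel R (map f ys @ z # xs)" z]
      Eq_replace[of "f x" x "Rel R (map f ys @ z # xs)" z] Cons.prems Eq_sym unfolding s by auto
  also have "\<dots> \<longleftrightarrow> Rel R (map f (ys @ [x]) @ xs) \<in> \<Gamma>" by simp
  also have "\<dots> \<longleftrightarrow> Rel R (map f (ys @ x # xs)) \<in> \<Gamma>" using Cons.IH[of "ys @ [x]"] Cons.prems by simp
  finally show ?case .
qed simp

text \<open>\<open>sat\<close> reads \<open>Eq\<close> as identity, so variables equated in
  \<open>\<Gamma>\<close> must become one element. The least equal witness is a canonical
  representative, and the domain stays a set of numbers.\<close>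

definition rep :: "nat \<Rightarrow> nat" where "rep v = (LEAST w. w \<in> W \<and> Eq v w \<in> \<Gamma>)"

lemma rep: "rep v \<in> W" "Eq v (rep v) \<in> \<Gamma>"
proof -
  \<comment> \<open>\<open>v\<close> itself is a counterexample to this universal formula, so some
    witness is equal to \<open>v\<close>.\<close>
  have "All (Suc v) (Neg (Eq v (Suc v))) \<notin> \<Gamma>"
  proof
    assume "All (Suc v) (Neg (Eq v (Suc v))) \<in> \<Gamma>"
    then have "subst (Suc v) v (Neg (Eq v (Suc v))) \<in> \<Gamma>"
      using \<Gamma>_logax logax.inst[of v "Suc v" "Neg (Eq v (Suc v))"] by (simp add: Neg_def)
    then have "Neg (Eq v v) \<in> \<Gamma>" by (simp add: Neg_def sv_def)
    then show False using Eq_refl Neg_in_\<Gamma> by blast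
  qed
  then obtain w where "w \<in> W" "subst (Suc v) w (Neg (Eq v (Suc v))) \<notin> \<Gamma>" using All_witness by blast
  then have "w \<in> W \<and> Eq v w \<in> \<Gamma>" using Neg_in_\<Gamma>[of "Eq v w"] by (simp add: Neg_def sv_def)
  then have "rep v \<in> W \<and> Eq v (rep v) \<in> \<Gamma>" unfolding rep_def by (rule LeastI)
  then show "rep v \<in> W" "Eq v (rep v) \<in> \<Gamma>" by auto
qed

lemma rep_eq: "rep a = rep b \<longleftrightarrow> Eq a b \<in> \<Gamma>"
proof
  assume "rep a = rep b"
  then show "Eq a b \<in> \<Gamma>" using rep Eq_sym Eq_trans by metis
next
  assume "Eq a b \<in> \<Gamma>"
  then have "Eq a w \<in> \<Gamma> \<longleftrightarrow> Eq b w \<in> \<Gamma>" for w using Eq_sym Eq_trans by metis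
  then show "rep a = rep b" unfolding rep_def by simp
qed

lemma rep_rep: "rep (rep v) = rep v"
  using rep_eq rep Eq_sym by blast

definition mem where "mem a b \<longleftrightarrow> Mem a b \<in> \<Gamma>"
definition rel where "rel R xs \<longleftrightarrow> Rel R xs \<in> \<Gamma>"
text \<open>The domain has only the relation variables indexed by \<open>W\<close>, since
  \<open>AllR_witness\<close> finds its counterexamples there. No quotient is taken, as the language
  cannot equate relations.\<close>

definition rels where "rels n = (\<lambda>i. rel (i, n)) ` W"

lemma truth:
  "bv p \<subseteq> - W \<Longrightarrow> fst ` brv p \<subseteq> - W \<Longrightarrow> sat (range rep) mem rels rep rel p \<longleftrightarrow> p \<in> \<Gamma>"
proof (induction "fsize p" arbitrary: p rule: less_induct)
  case less
  show ?case
  proof (cases p)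
    case (Mem a b)
    then show ?thesis using Mem_replace[of a "rep a" b "rep b"] Mem_replace[of "rep a" a "rep b" b] rep Eq_sym
      by (auto simp: mem_def)
  next
    case (Rel R xs)
    then show ?thesis using Rel_replace[of rep R "[]" xs] rep by (auto simp: rel_def)
  next
    case (Imp q s)
    then show ?thesis using less by (simp add: Imp_in_\<Gamma> image_Un)
  next
    case (All x q)
    have IH: "sat (range rep) mem rels (rep(x := rep w)) rel q \<longleftrightarrow> subst x w q \<in> \<Gamma>" if "w \<in> W" for w
    proof -
      have "free_for w x q" using that less.prems All by (intro free_for_notin_bv) auto
      then show ?thesis using less.hyps[of "subst x w q"] less.prems All by (simp add: sat_subst)
    qed
    have "subst x w q \<in> \<Gamma>" if "p \<in> \<Gamma>" "w \<in> W" for w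
    proof -
      have "free_for w x q" using that less.prems All by (intro free_for_notin_bv) auto
      then show ?thesis using \<Gamma>_logax[OF logax.inst] that All by blast
    qed
    \<comment> \<open>Values of \<open>rep\<close> lie in \<open>W\<close> and \<open>rep\<close>
      fixes them, so the domain is the image of \<open>W\<close>.\<close>
    moreover have "sat (range rep) mem rels rep rel p \<longleftrightarrow>
        (\<forall>w\<in>W. sat (range rep) mem rels (rep(x := rep w)) rel q)"
      unfolding All sat.simps using rep rep_rep by (metis (no_types, lifting) rangeE rangeI)
    ultimately show ?thesis using IH All_witness All by blast
  next
    case (AllR R q)
    have fr: "rfree_for (i, snd R) R q" if "i \<in> W" for i
      using that less.prems AllR by (intro rfree_for_notin_brv) force
    have IH: "sat (range rep) mem rels rep (rel(R := rel (i, snd R))) q \<longleftrightarrow>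
        rsubst R (i, snd R) q \<in> \<Gamma>" if "i \<in> W" for i
      using less.hyps[of "rsubst R (i, snd R) q"] less.prems AllR fr[OF that] by (simp add: sat_rsubst)
    have "rsubst R (i, snd R) q \<in> \<Gamma>" if "p \<in> \<Gamma>" "i \<in> W" for i
      using \<Gamma>_logax[OF logax.instR[OF _ fr]] that AllR by simp
    moreover have "sat (range rep) mem rels rep rel p \<longleftrightarrow>
        (\<forall>i\<in>W. sat (range rep) mem rels rep (rel(R := rel (i, snd R))) q)"
      unfolding AllR by (simp add: rels_def)
    ultimately show ?thesis using IH AllR_witness AllR by blast
  qed (use Bot_notin_\<Gamma> rep_eq in auto)
qed

text \<open>Theorems may be generalized, so the closure of \<open>p\<close> lies in
  \<open>\<Gamma>\<close> and is true by \<open>truth\<close>. Being closed, it is true under every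
  assignment and can then be instantiated.\<close>

lemma theorem_valid:
  assumes "T \<turnstile> p" "fv p \<union> bv p \<subseteq> - W" "fst ` (frv p \<union> brv p) \<subseteq> - W"
  shows "valid (range rep) mem rels p"
proof -
  obtain xs Rs where xs: "set xs = fv p" and Rs: "set Rs = frv p"
    using finite_list finite_variables by metis
  let ?c = "alls xs (allRs Rs p)"
  have "?c \<in> \<Gamma>" using assms(1) by (intro \<Gamma>_theorem deriv_alls deriv_allRs)
  then have "sat (range rep) mem rels rep rel ?c"
    using assms by (subst truth) (auto simp: xs Rs)
  then have "sat (range rep) mem rels e r ?c" for e r
    by (subst sat_cong[of _ e rep r rel]) (auto simp: xs Rs)
  then show ?thesis unfolding valid_def using sat_allsD sat_allRsD by metis
qed

text \<open>The comprehension instances cannot be read off the truth lemma directly, because their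
  bound variables may be witnesses; renaming all variables injectively into the complement of
  \<open>W\<close> removes the clash.\<close>

lemma henkin_canonical: "henkin (range rep) mem rels"
  unfolding henkin_def
proof (intro allI impI)
  fix p R and vs :: "nat list"
  assume p: "wf p" "R \<notin> frv p" "distinct vs" "length vs = snd R"
  let ?q = "ExR R (alls vs (Iff (Rel R vs) p))"
  obtain f :: "nat \<Rightarrow> nat" where f: "inj f" "range f \<subseteq> - W"
    using infinite_countable_subset[OF coinf] by blast
  have "inj (rren f)" using f(1) by (rule inj_rren)
  then have "rren f R \<notin> frv (ren f p)" using p f by (auto simp: frv_ren inj_eq)
  then have "T \<turnstile> ren f ?q"
    using p inj_on_subset[OF f(1)]
    by (auto simp: distinct_map intro!: deriv.log logax.compr)
  then have v: "valid (range rep) mem rels (ren f ?q)"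
  proof (rule theorem_valid)
    show "fv (ren f ?q) \<union> bv (ren f ?q) \<subseteq> - W"
      using ren_variables(1,2) f(2) by (meson Un_least order_trans)
    show "fst ` (frv (ren f ?q) \<union> brv (ren f ?q)) \<subseteq> - W"
      unfolding image_Un using ren_variables(3,4) f(2) by (meson Un_least order_trans)
  qed
  show "valid (range rep) mem rels ?q"
    unfolding valid_def
  proof (intro allI impI)
    fix e :: "nat \<Rightarrow> nat" and r :: "rvar \<Rightarrow> nat list \<Rightarrow> bool"
    assume er: "\<forall>x. e x \<in> range rep" "\<forall>R. r R \<in> rels (snd R)"
    \<comment> \<open>Precomposing with the inverse of \<open>f\<close> makes the renamed formula
      read the values of \<open>e\<close> and \<open>r\<close>.\<close>
    let ?e = "\<lambda>x. e (inv f x)" and ?r = "\<lambda>R. r (rren (inv f) R)"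
    have "\<forall>x. ?e x \<in> range rep" using er(1) by blast
    moreover have "\<forall>R. ?r R \<in> rels (snd R)" using er(2) by (metis rren_simps(2))
    ultimately have "sat (range rep) mem rels ?e ?r (ren f ?q)" by (rule validD[OF v])
    moreover have "(\<lambda>x. ?e (f x)) = e" "(\<lambda>R. ?r (rren f R)) = r"
      using f(1) by (auto simp: fun_eq_iff rren_def)
    ultimately show "sat (range rep) mem rels e r ?q" by (simp only: sat_ren[OF f(1)])
  qed
qed

end

theorem completeness:
  assumes "finite T" "fv p = {}" "frv p = {}" "\<not> T \<turnstile> p"
  obtains U :: "nat set" and E Q
  where "henkin U E Q" "\<forall>q\<in>T. valid U E Q q" "\<not> valid U E Q p"
proof -
  define V where "V = (\<Union>q\<in>insert p T. fv q \<union> bv q \<union> fst ` (frv q \<union> brv q))"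
  \<comment> \<open>\<open>V\<close> is finite, so infinitely many odd numbers remain in
    \<open>W\<close>; the even ones stay outside, as room for the renaming in
    \<open>henkin_canonical\<close>.\<close>
  define W where "W = {v. odd v} - V"
  have "finite V" unfolding V_def using assms(1) by auto
  moreover have "infinite {v::nat. odd v}" "infinite {v::nat. even v}"
    unfolding infinite_nat_iff_unbounded mem_Collect_eq by (meson even_Suc less_Suc_eq lessI)+
  moreover have "{v. even v} \<subseteq> - W" unfolding W_def by auto
  ultimately have inf: "infinite W" "infinite (- W)"
    unfolding W_def by (auto dest: finite_subset)
  have "\<not> T \<turnstile> imps [Neg p] Bot"
    using assms(4) deriv.mp[OF deriv.log[OF logax.ax3]] by (auto simp: Neg_def)
  then interpret henkin_construction T W "[Neg p]" using inf by unfold_locales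
  have V: "fv q \<union> bv q \<subseteq> - W" "fst ` (frv q \<union> brv q) \<subseteq> - W" if "q \<in> insert p T" for q
    using that unfolding W_def V_def by auto
  have "Neg p \<in> \<Gamma>" using in_\<Gamma>I[of 0] imps_hyp[of T "Neg p" "[]"] by simp
  then have "\<not> sat (range rep) mem rels rep rel p"
    using truth[of p] V[of p] Neg_in_\<Gamma> by auto
  moreover obtain i where i: "i \<in> W" using inf by fastforce
  \<comment> \<open>\<open>rel\<close> is not known to be admissible at indices outside
    \<open>W\<close>. Since \<open>p\<close> has no free relation variables, an assignment using
    only the index \<open>i\<close> can replace it.\<close>
  moreover have "sat (range rep) mem rels rep rel p = sat (range rep) mem rels rep (\<lambda>R. rel (i, snd R)) p"
    by (rule sat_cong) (use assms(2,3) in auto)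
  moreover have "\<forall>R. rel (i, snd R) \<in> rels (snd R)" using i by (auto simp: rels_def)
  ultimately have "\<not> valid (range rep) mem rels p"
    using validD[of "range rep" mem rels p rep "\<lambda>R. rel (i, snd R)"] by auto
  moreover have "valid (range rep) mem rels q" if "q \<in> T" for q
    using that V[of q] by (intro theorem_valid deriv.hyp) auto
  ultimately show thesis using that[OF henkin_canonical] by auto
qed

section \<open>Boolean-levels in models of BLT\<close>

text \<open>The domain is a parameter because the ordinary notions will be read in the helow part of
  \<open>U\<close> and the boolean ones in \<open>U\<close>.\<close>

definition sub where "sub U E a b \<longleftrightarrow> (\<forall>z\<in>U. E z a \<longrightarrow> E z b)"
definition cosub where "cosub U E a b \<longleftrightarrow> (\<forall>z\<in>U. \<not> E z a \<longrightarrow> E z b)"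

definition helow where
  "helow U E a \<longleftrightarrow> (\<exists>c\<in>U. (\<forall>y\<in>U. E y c \<longrightarrow> sub U E y c) \<and> sub U E a c \<and> (\<forall>y\<in>U. E y c \<longrightarrow> \<not> E y y))"

definition history where
  "history U E h \<longleftrightarrow> (\<forall>x\<in>U. E x h \<longrightarrow>
     (\<forall>m\<in>U. E m x \<longleftrightarrow> (\<exists>c\<in>U. E c x \<and> E c h \<and> sub U E m c)))"

definition level where
  "level U E s \<longleftrightarrow> (\<exists>h\<in>U. history U E h \<and> (\<forall>x\<in>U. E x s \<longleftrightarrow> (\<exists>c\<in>U. E c h \<and> sub U E x c)))"

definition bhistory where
  "bhistory U E h \<longleftrightarrow> \<not> E h h \<and> (\<forall>x\<in>U. E x h \<longrightarrow>
     (\<forall>m\<in>U. E m x \<longleftrightarrow> (\<exists>c\<in>U. E c x \<and> E c h \<and> \<not> E c c \<and> (sub U E m c \<or> cosub U E m c))))"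

definition blevel where
  "blevel U E s \<longleftrightarrow> (\<exists>h\<in>U. bhistory U E h \<and>
     (\<forall>x\<in>U. E x s \<longleftrightarrow> (\<exists>c\<in>U. E c h \<and> \<not> E c c \<and> (sub U E x c \<or> cosub U E x c))))"

text \<open>The encoded notions choose bound variables as successors of a maximum; these
  inequalities let the simplifier look up values past the updates.\<close>

lemma Suc_max_fresh [simp]:
  "Suc (max a b) \<noteq> a" "Suc (max a b) \<noteq> b" "a \<noteq> Suc (max a b)" "b \<noteq> Suc (max a b)"
  "Suc (Suc (max a b)) \<noteq> a" "Suc (Suc (max a b)) \<noteq> b" "a \<noteq> Suc (Suc (max a b))" "b \<noteq> Suc (Suc (max a b))"
  by linarith+

lemma Suc_max3_fresh [simp]:
  "Suc (max a (max b c)) \<noteq> a" "Suc (max a (max b c)) \<noteq> b" "Suc (max a (max b c)) \<noteq> c"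
  "Suc (Suc (max a (max b c))) \<noteq> a" "Suc (Suc (max a (max b c))) \<noteq> b" "Suc (Suc (max a (max b c))) \<noteq> c"
  "a \<noteq> Suc (max a (max b c))" "b \<noteq> Suc (max a (max b c))" "c \<noteq> Suc (max a (max b c))"
  "a \<noteq> Suc (Suc (max a (max b c)))" "b \<noteq> Suc (Suc (max a (max b c)))" "c \<noteq> Suc (Suc (max a (max b c)))"
  by linarith+

lemma sat_Sub [simp]: "sat U E Q e r (Sub a b) = sub U E (e a) (e b)"
  by (simp add: Sub_def sub_def Let_def)

lemma sat_CoSub [simp]: "sat U E Q e r (CoSub a b) = cosub U E (e a) (e b)"
  by (simp add: CoSub_def cosub_def Let_def)

lemma sat_Helow [simp]: "sat U E Q e r (Helow a) = helow U E (e a)"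
  by (simp add: Helow_def helow_def Trans_def Let_def sub_def[of U E _ "_ :: 'a"])

lemma sat_IsPotInter [simp]: "sat U E Q e r (IsPotInter b a h) \<longleftrightarrow>
    (\<forall>m\<in>U. E m (e b) \<longleftrightarrow> (\<exists>c\<in>U. E c (e a) \<and> E c (e h) \<and> sub U E m c))"
  by (simp add: IsPotInter_def Let_def conj_assoc)

lemma sat_IsPot [simp]: "sat U E Q e r (IsPot s h) \<longleftrightarrow>
    (\<forall>x\<in>U. E x (e s) \<longleftrightarrow> (\<exists>c\<in>U. E c (e h) \<and> sub U E x c))"
  by (simp add: IsPot_def Let_def)

lemma sat_Level [simp]: "sat U E Q e r (Level s) = level U E (e s)"
  by (simp add: Level_def level_def History_def history_def Let_def)

lemma sat_IsBPotInter [simp]: "sat U E Q e r (IsBPotInter b a h) \<longleftrightarrow>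
    (\<forall>m\<in>U. E m (e b) \<longleftrightarrow>
      (\<exists>c\<in>U. E c (e a) \<and> E c (e h) \<and> \<not> E c c \<and> (sub U E m c \<or> cosub U E m c)))"
  by (simp add: IsBPotInter_def Let_def conj_assoc)

lemma sat_IsBPot [simp]: "sat U E Q e r (IsBPot s h) \<longleftrightarrow>
    (\<forall>x\<in>U. E x (e s) \<longleftrightarrow> (\<exists>c\<in>U. E c (e h) \<and> \<not> E c c \<and> (sub U E x c \<or> cosub U E x c)))"
  by (simp add: IsBPot_def Let_def)

lemma sat_BLevel [simp]: "sat U E Q e r (BLevel s) = blevel U E (e s)"
  by (simp add: BLevel_def blevel_def BHistory_def bhistory_def Let_def)

lemma notions_wf [simp]: "wf (Sub a b)" "wf (Helow a)" "wf (BLevel a)"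
  by (simp_all add: Sub_def Helow_def Trans_def BLevel_def BHistory_def IsBPotInter_def IsBPot_def
      CoSub_def Let_def)

lemma Helow_variables [simp]: "fv (Helow a) = {a}" "frv (Helow a) = {}"
  by (auto simp: Sub_def Helow_def Trans_def Let_def)

lemma relh_variables [simp]: "fv (relh p) = fv p" "frv (relh p) = frv p" "wf (relh p) = wf p"
  by (induction p) auto

abbreviation hpart :: "'a set \<Rightarrow> ('a \<Rightarrow> 'a \<Rightarrow> bool) \<Rightarrow> 'a set" where
  "hpart U E \<equiv> {x \<in> U. helow U E x}"

lemma sat_relh: "sat U E Q e r (relh p) = sat (hpart U E) E Q e r p"
  by (induction p arbitrary: e r) auto

lemma sat_alls_mono:
  assumes "V \<subseteq> U" "\<And>e. sat U E Q e r p \<Longrightarrow> sat V E Q e r q"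
  shows "sat U E Q e r (alls vs p) \<Longrightarrow> sat V E Q e r (alls vs q)"
  using assms by (induction vs arbitrary: e) auto

text \<open>Comprehension for \<open>p\<close> over the helow part is comprehension for
  \<open>relh p\<close> over \<open>U\<close>. The relation found there serves unchanged, because it
  is tested only at helow arguments.\<close>

lemma henkin_hpart:
  assumes "henkin U E Q"
  shows "henkin (hpart U E) E Q"
  unfolding henkin_def valid_def
proof (intro allI impI)
  fix p R and vs :: "nat list" and e :: "nat \<Rightarrow> 'a" and r :: "rvar \<Rightarrow> 'a list \<Rightarrow> bool"
  assume p: "wf p" "R \<notin> frv p" "distinct vs" "length vs = snd R"
    and e: "\<forall>x. e x \<in> hpart U E" and r: "\<forall>R. r R \<in> Q (snd R)"
  have "valid U E Q (ExR R (alls vs (Iff (Rel R vs) (relh p))))"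
    using assms p by (intro henkinD) auto
  then have "sat U E Q e r (ExR R (alls vs (Iff (Rel R vs) (relh p))))"
    by (rule validD) (use e r in auto)
  then obtain X where X: "X \<in> Q (snd R)" "sat U E Q e (r(R := X)) (alls vs (Iff (Rel R vs) (relh p)))"
    by auto
  have "sat (hpart U E) E Q e (r(R := X)) (alls vs (Iff (Rel R vs) p))"
    by (rule sat_alls_mono[OF _ _ X(2)]) (auto simp: sat_relh)
  with X(1) show "sat (hpart U E) E Q e r (ExR R (alls vs (Iff (Rel R vs) p)))" by auto
qed

text \<open>\<open>valid\<close> is informative only if some assignment is admissible;
  \<open>u\<close> and \<open>r\<close> provide one. With \<open>r\<close> as a parameter, a given
  relation can enter comprehension by interpreting the locale again with \<open>r\<close>
  updated.\<close>

locale blt_model =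
  fixes U :: "'a set" and E :: "'a \<Rightarrow> 'a \<Rightarrow> bool" and Q :: "nat \<Rightarrow> ('a list \<Rightarrow> bool) set"
    and u :: 'a and r :: "rvar \<Rightarrow> 'a list \<Rightarrow> bool"
  assumes henkin: "henkin U E Q" and BLT: "\<forall>p\<in>BLT. valid U E Q p"
    and u: "u \<in> U" and r: "\<forall>R. r R \<in> Q (snd R)"
begin

abbreviation "Sub' \<equiv> sub U E"
abbreviation "H \<equiv> helow U E"
abbreviation "BL \<equiv> blevel U E"

lemma valid_sat: "valid U E Q p \<Longrightarrow> sat U E Q (\<lambda>_. u) r p"
  by (rule validD) (use u r in auto)

section \<open>Consequences of the axioms in a Henkin model\<close>

lemma extensionality:
  assumes "a \<in> U" "b \<in> U" "\<And>x. x \<in> U \<Longrightarrow> E x a \<longleftrightarrow> E x b"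
  shows "a = b"
proof -
  have "sat U E Q (\<lambda>_. u) r ax_Ext" by (rule valid_sat) (use BLT in \<open>auto simp: BLT_def\<close>)
  then show ?thesis using assms by (simp add: ax_Ext_def)
qed

lemma complement:
  assumes "a \<in> U"
  obtains c where "c \<in> U" "\<And>x. x \<in> U \<Longrightarrow> E x c \<longleftrightarrow> \<not> E x a" "\<not> E a a \<longleftrightarrow> E c c"
proof -
  have "sat U E Q (\<lambda>_. u) r ax_Compl" by (rule valid_sat) (use BLT in \<open>auto simp: BLT_def\<close>)
  then have "\<exists>c\<in>U. (\<forall>x\<in>U. E x c \<longleftrightarrow> \<not> E x a) \<and> (\<not> E a a \<longleftrightarrow> E c c)"
    using assms by (simp add: ax_Compl_def IsCompl_def Let_def)
  then show thesis using that by blast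
qed

lemma stratification:
  assumes "a \<in> U" "\<not> E a a"
  obtains s where "s \<in> U" "BL s" "Sub' a s"
proof -
  have "sat U E Q (\<lambda>_. u) r ax_StratN" by (rule valid_sat) (use BLT in \<open>auto simp: BLT_def\<close>)
  then show thesis using that assms by (auto simp: ax_StratN_def)
qed

lemma separation_rel:
  assumes "X \<in> Q 1" "a \<in> U" "\<not> E a a"
  shows "\<exists>b\<in>U. \<not> E b b \<and> (\<forall>x\<in>U. E x b \<longleftrightarrow> X [x] \<and> E x a)"
proof -
  have "sat U E Q (\<lambda>_. u) r ax_SepN" by (rule valid_sat) (use BLT in \<open>auto simp: BLT_def\<close>)
  then show ?thesis using assms by (simp add: ax_SepN_def)
qed

lemma comprehension1:
  assumes "wf p" "\<forall>x. e x \<in> U"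
  shows "\<exists>X\<in>Q 1. \<forall>x\<in>U. X [x] \<longleftrightarrow> sat U E Q (e(0 := x)) r p"
proof -
  obtain i where "i \<notin> fst ` frv p" using ex_new_if_finite[OF infinite_UNIV_nat]
    by (metis finite_imageI finite_variables(3))
  then have i: "(i, 1) \<notin> frv p" by force
  have "valid U E Q (ExR (i, 1) (alls [0] (Iff (Rel (i, 1) [0]) p)))"
    using henkin assms(1) i by (intro henkinD) auto
  then have "sat U E Q e r (ExR (i, 1) (alls [0] (Iff (Rel (i, 1) [0]) p)))"
    by (rule validD) (use assms r in auto)
  then show ?thesis using i by (auto simp: sat_upd_notin_frv)
qed

lemma comprehension2:
  assumes "wf p" "\<forall>x. e x \<in> U"
    and P: "\<And>x y. x \<in> U \<Longrightarrow> y \<in> U \<Longrightarrow> P x y \<longleftrightarrow> sat U E Q (e(0 := x, 1 := y)) r p"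
  shows "\<exists>X\<in>Q 2. \<forall>x\<in>U. \<forall>y\<in>U. X [x, y] \<longleftrightarrow> P x y"
proof -
  obtain i where "i \<notin> fst ` frv p" using ex_new_if_finite[OF infinite_UNIV_nat]
    by (metis finite_imageI finite_variables(3))
  then have i: "(i, 2) \<notin> frv p" by force
  have "valid U E Q (ExR (i, 2) (alls [0, 1] (Iff (Rel (i, 2) [0, 1]) p)))"
    using henkin assms(1) i by (intro henkinD) auto
  then have "sat U E Q e r (ExR (i, 2) (alls [0, 1] (Iff (Rel (i, 2) [0, 1]) p)))"
    by (rule validD) (use assms r in auto)
  then show ?thesis using i P by (auto simp: sat_upd_notin_frv)
qed

text \<open>The class is given semantically by \<open>P\<close>, while \<open>p\<close> certifies
  that it is definable: variable 0 is the argument and \<open>e\<close> carries the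
  parameters.\<close>

lemma separation:
  assumes "wf p" "\<forall>x. e x \<in> U" and a: "a \<in> U" "\<not> E a a"
    and P: "\<And>x. x \<in> U \<Longrightarrow> P x \<longleftrightarrow> sat U E Q (e(0 := x)) r p"
  shows "\<exists>b\<in>U. \<not> E b b \<and> (\<forall>x\<in>U. E x b \<longleftrightarrow> P x \<and> E x a)"
proof -
  obtain X where X: "X \<in> Q 1" "\<forall>x\<in>U. X [x] \<longleftrightarrow> sat U E Q (e(0 := x)) r p"
    using comprehension1[OF assms(1,2)] by blast
  obtain b where "b \<in> U" "\<not> E b b" "\<forall>x\<in>U. E x b \<longleftrightarrow> X [x] \<and> E x a"
    using separation_rel[OF X(1) a] by blast
  then show ?thesis using X(2) P by (intro bexI[of _ b]) auto
qed

text \<open>Separation cuts out of \<open>a\<close> a low set with the same members as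
  \<open>b\<close>, and this is \<open>b\<close> by extensionality.\<close>

lemma subset_low:
  assumes "a \<in> U" "b \<in> U" "\<not> E a a" "Sub' b a"
  shows "\<not> E b b"
proof -
  obtain c where c: "c \<in> U" "\<not> E c c" "\<forall>x\<in>U. E x c \<longleftrightarrow> E x b \<and> E x a"
    using separation[of "Mem 0 1" "\<lambda>_. b" a "\<lambda>x. E x b"] assms by auto
  then have "c = b" using assms extensionality[of c b] by (auto simp: sub_def)
  then show ?thesis using c by simp
qed

text \<open>The complement of a low set is high, so \<open>subset_low\<close> keeps it from being
  included in a low set. This disposes of the complement clause of bpot whenever the member in
  question is low.\<close>

lemma low_not_cosub:
  assumes "a \<in> U" "x \<in> U" "\<not> E a a" "\<not> E x x"
  shows "\<not> cosub U E x a"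
proof
  assume co: "cosub U E x a"
  obtain c where "c \<in> U" "\<And>y. y \<in> U \<Longrightarrow> E y c \<longleftrightarrow> \<not> E y x" "\<not> E x x \<longleftrightarrow> E c c"
    using complement assms by metis
  moreover from this have "Sub' c a" using co by (auto simp: sub_def cosub_def)
  ultimately show False using subset_low[of a c] assms by blast
qed

definition potent where
  "potent y \<longleftrightarrow> (\<forall>z\<in>U. \<forall>x\<in>U. E z y \<longrightarrow> \<not> E z z \<longrightarrow> Sub' x z \<longrightarrow> E x y)"

text \<open>Scott's argument: without a minimal element, the low members of the intersection of the
  class would form a set which, by potency, belongs to every member of the class, and would
  therefore be a Russell set.\<close>

lemma potent_minimal:
  assumes "wf q" "\<forall>x. e x \<in> U" and F: "\<And>x y. x \<in> U \<Longrightarrow> y \<in> U \<Longrightarrow> F y \<longleftrightarrow> sat U E Q (e(0 := x, 1 := y)) r q"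
    and pot: "\<And>y. y \<in> U \<Longrightarrow> F y \<Longrightarrow> \<not> E y y \<and> potent y" and y0: "y0 \<in> U" "F y0"
  shows "\<exists>y\<in>U. F y \<and> (\<forall>z\<in>U. F z \<longrightarrow> \<not> E z y)"
proof (rule ccontr)
  assume "\<not> ?thesis"
  then have no_min: "\<exists>z\<in>U. F z \<and> E z y" if "y \<in> U" "F y" for y using that by blast
  \<comment> \<open>Variable 0 is the candidate element here, so \<open>q\<close> must define
    \<open>F\<close> whatever variable 0 denotes; hence the \<open>x\<close> in the assumption on
    \<open>F\<close>.\<close>
  let ?p = "And (Neg (Mem 0 0)) (All 1 (Imp q (Mem 0 1)))"
  have "(\<not> E x x \<and> (\<forall>y\<in>U. F y \<longrightarrow> E x y)) = sat U E Q (e(0 := x)) r ?p" if x: "x \<in> U" for x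
    using F[OF x] by simp
  then have "\<exists>b\<in>U. \<not> E b b \<and> (\<forall>x\<in>U. E x b \<longleftrightarrow> (\<not> E x x \<and> (\<forall>y\<in>U. F y \<longrightarrow> E x y)) \<and> E x y0)"
    using assms(1,2) y0 pot[OF y0] by (intro separation[of ?p e]) auto
  then obtain c where c: "c \<in> U" "\<not> E c c" and c': "\<forall>x\<in>U. E x c \<longleftrightarrow> \<not> E x x \<and> (\<forall>y\<in>U. F y \<longrightarrow> E x y)"
    using y0 by blast
  have "E c y" if y: "y \<in> U" "F y" for y
  proof -
    obtain z where z: "z \<in> U" "F z" "E z y" using no_min y by blast
    then have "Sub' c z" using c' by (auto simp: sub_def)
    then show ?thesis using pot[OF y] pot[of z] z c(1) unfolding potent_def by blast
  qed
  then show False using c c' by blast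
qed

text \<open>A low \<open>z\<close> enters \<open>y\<close> as a subset of a low \<open>c\<close> in
  \<open>y\<close> and \<open>h\<close>, and subsets of \<open>z\<close> are subsets of the same
  \<open>c\<close>.\<close>

lemma bhistory_potent:
  assumes h: "bhistory U E h" and y: "y \<in> U" "E y h"
  shows "potent y"
  unfolding potent_def
proof (intro ballI impI)
  fix z x assume z: "z \<in> U" "E z y" "\<not> E z z" and x: "x \<in> U" "Sub' x z"
  obtain c where c: "c \<in> U" "E c y" "E c h" "\<not> E c c" "Sub' z c \<or> cosub U E z c"
    using h y z unfolding bhistory_def by blast
  then have "Sub' z c" using low_not_cosub[of c z] z by blast
  then have "Sub' x c" using x by (auto simp: sub_def)
  then show "E x y" using h y x c unfolding bhistory_def by blast
qed

text \<open>In a membership-minimal counterexample \<open>y\<close>, a low member \<open>x\<close>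
  is included in some low \<open>d\<close> in both \<open>y\<close> and \<open>h\<close>. By
  minimality the low members of \<open>d\<close> are subsets of \<open>d\<close>, and this forces
  \<open>d\<close> to be included in \<open>y\<close>.\<close>

lemma bhistory_transitive:
  assumes h: "h \<in> U" "bhistory U E h" and y: "y \<in> U" "E y h" "\<not> E y y"
    and x: "x \<in> U" "E x y" "\<not> E x x"
  shows "Sub' x y"
proof (rule ccontr)
  assume "\<not> Sub' x y"
  define F where "F y \<longleftrightarrow> E y h \<and> \<not> E y y \<and> \<not> (\<forall>x\<in>U. E x y \<longrightarrow> \<not> E x x \<longrightarrow> Sub' x y)" for y
  have "\<exists>y\<in>U. F y \<and> (\<forall>z\<in>U. F z \<longrightarrow> \<not> E z y)"
  proof (rule potent_minimal[of "And (Mem 1 2) (And (Neg (Mem 1 1))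
        (Neg (All 3 (Imp (Mem 3 1) (Imp (Neg (Mem 3 3)) (Sub 3 1))))))" "\<lambda>_. h"])
    show "F y" using y x \<open>\<not> Sub' x y\<close> unfolding F_def by blast
  qed (use h y bhistory_potent in \<open>auto simp: F_def\<close>)
  then obtain y where y: "y \<in> U" "E y h" "\<not> E y y" "F y" and min: "\<forall>z\<in>U. F z \<longrightarrow> \<not> E z y"
    unfolding F_def by blast
  have pot: "potent y" using bhistory_potent h y by blast
  have "Sub' x y" if x: "x \<in> U" "E x y" "\<not> E x x" for x
  proof -
    obtain d where d: "d \<in> U" "E d y" "E d h" "\<not> E d d" "Sub' x d \<or> cosub U E x d"
      using h y x unfolding bhistory_def by blast
    then have xd: "Sub' x d" using low_not_cosub[of d x] x by blast
    have d_trans: "\<forall>x\<in>U. E x d \<longrightarrow> \<not> E x x \<longrightarrow> Sub' x d" using min d unfolding F_def by blast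
    \<comment> \<open>\<open>m\<close> may be high, so it is followed through the low
      \<open>c\<close> that generates it in \<open>d\<close>: \<open>c\<close> is included in
      \<open>d\<close>, potency moves \<open>c\<close> into \<open>y\<close>, and there
      \<open>c\<close> generates \<open>m\<close> again.\<close>
    have "E m y" if m: "m \<in> U" "E m d" for m
    proof -
      obtain c where c: "c \<in> U" "E c d" "E c h" "\<not> E c c" "Sub' m c \<or> cosub U E m c"
        using h d m unfolding bhistory_def by blast
      then have "E c y" using d_trans d pot unfolding potent_def by blast
      then show ?thesis using h y c m unfolding bhistory_def by blast
    qed
    then show ?thesis using xd by (auto simp: sub_def)
  qed
  then show False using y(4) unfolding F_def by blast
qed

text \<open>The history of \<open>y\<close> consists of its low members in \<open>h\<close>: bpot
  ignores high generators, and \<open>bhistory_transitive\<close> shows that members of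
  \<open>k\<close> keep all their low generators.\<close>

lemma bhistory_blevel:
  assumes h: "h \<in> U" "bhistory U E h" and y: "y \<in> U" "E y h" "\<not> E y y"
  shows "BL y"
proof -
  have "\<exists>k\<in>U. \<not> E k k \<and> (\<forall>x\<in>U. E x k \<longleftrightarrow> (E x y \<and> \<not> E x x) \<and> E x h)"
    by (rule separation[of "And (Mem 0 1) (Neg (Mem 0 0))" "\<lambda>_. y"])
      (use h y in \<open>auto simp: bhistory_def\<close>)
  then obtain k where k: "k \<in> U" "\<not> E k k" and in_k: "\<forall>x\<in>U. E x k \<longleftrightarrow> E x y \<and> \<not> E x x \<and> E x h" by blast
  have "E m x \<longleftrightarrow> (\<exists>c\<in>U. E c x \<and> E c k \<and> \<not> E c c \<and> (Sub' m c \<or> cosub U E m c))"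
    if x: "x \<in> U" "E x k" and m: "m \<in> U" for x m
  proof -
    have x': "E x y" "\<not> E x x" "E x h" using x in_k by auto
    then have xy: "Sub' x y" using bhistory_transitive h y x by blast
    have "E m x \<longleftrightarrow> (\<exists>c\<in>U. E c x \<and> E c h \<and> \<not> E c c \<and> (Sub' m c \<or> cosub U E m c))"
      using h x x' m unfolding bhistory_def by blast
    moreover have "E c h \<longleftrightarrow> E c k" if "c \<in> U" "E c x" "\<not> E c c" for c
      using that xy in_k unfolding sub_def by blast
    ultimately show ?thesis by blast
  qed
  then have "bhistory U E k" using k unfolding bhistory_def by blast
  moreover have "E m y \<longleftrightarrow> (\<exists>c\<in>U. E c k \<and> \<not> E c c \<and> (Sub' m c \<or> cosub U E m c))" if m: "m \<in> U" for m
  proof -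
    have "E m y \<longleftrightarrow> (\<exists>c\<in>U. E c y \<and> E c h \<and> \<not> E c c \<and> (Sub' m c \<or> cosub U E m c))"
      using h y m unfolding bhistory_def by blast
    then show ?thesis using in_k by blast
  qed
  ultimately show ?thesis using k unfolding blevel_def by blast
qed

text \<open>All four are read off one history \<open>h\<close> of \<open>s\<close>. A low member of
  \<open>s\<close> is included in a low member of \<open>h\<close> by \<open>low_not_cosub\<close>,
  and each member of \<open>h\<close> is included in \<open>s\<close>, since its generators lie in
  \<open>h\<close>.\<close>

lemma blevel_props:
  assumes s: "s \<in> U" "BL s"
  shows blevel_low: "\<not> E s s"
    and blevel_step: "\<lbrakk>x \<in> U; E x s; \<not> E x x\<rbrakk> \<Longrightarrow> \<exists>q\<in>U. BL q \<and> E q s \<and> \<not> E q q \<and> Sub' x q"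
    and blevel_transitive: "\<lbrakk>x \<in> U; E x s; \<not> E x x\<rbrakk> \<Longrightarrow> Sub' x s"
    and blevel_potent: "potent s"
proof -
  obtain h where h: "h \<in> U" "bhistory U E h"
    and in_s: "\<forall>x\<in>U. E x s \<longleftrightarrow> (\<exists>c\<in>U. E c h \<and> \<not> E c c \<and> (Sub' x c \<or> cosub U E x c))"
    using s(2) unfolding blevel_def by blast
  have hlow: "\<not> E h h" using h unfolding bhistory_def by blast
  have below: "\<exists>c\<in>U. E c h \<and> \<not> E c c \<and> Sub' x c" if "x \<in> U" "E x s" "\<not> E x x" for x
    using that in_s low_not_cosub by blast
  have sub_s: "Sub' c s" if "c \<in> U" "E c h" for c
    using that in_s h unfolding bhistory_def sub_def[of U E c s] by blast
  have "Sub' c c" for c by (simp add: sub_def)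
  then have h_s: "E c s" if "c \<in> U" "E c h" "\<not> E c c" for c using that in_s by blast
  show "\<exists>q\<in>U. BL q \<and> E q s \<and> \<not> E q q \<and> Sub' x q" if "x \<in> U" "E x s" "\<not> E x x"
    using below[OF that] bhistory_blevel h h_s by blast
  show "Sub' x s" if "x \<in> U" "E x s" "\<not> E x x"
    using below[OF that] sub_s unfolding sub_def by blast
  show "potent s"
    unfolding potent_def
  proof (intro ballI impI)
    fix z x assume z: "z \<in> U" "E z s" "\<not> E z z" and x: "x \<in> U" "Sub' x z"
    obtain c where "c \<in> U" "E c h" "\<not> E c c" "Sub' z c" using below z by blast
    moreover have "Sub' x c" using x(2) \<open>Sub' z c\<close> by (auto simp: sub_def)
    ultimately show "E x s" using in_s x by blast
  qed
  \<comment> \<open>A high boolean-level would contain everything, hence its own history.\<close>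
  show "\<not> E s s"
  proof
    assume "E s s"
    then obtain c where c: "c \<in> U" "E c h" "\<not> E c c" "Sub' s c \<or> cosub U E s c" using in_s s by blast
    moreover have "\<not> Sub' s c" using c \<open>E s s\<close> subset_low s by blast
    ultimately have "E x s" if "x \<in> U" for x
      using that sub_s[of c] unfolding cosub_def sub_def by blast
    then obtain d where "d \<in> U" "E d h" "\<not> E d d" "Sub' h d" using below h hlow by blast
    then show False unfolding sub_def by blast
  qed
qed

section \<open>Helow sets and the helow parts of boolean-levels\<close>

lemma helow_low:
  assumes "a \<in> U" "H a"
  shows "\<not> E a a"
  using assms unfolding helow_def sub_def by blast

lemma helow_member: "H a \<Longrightarrow> x \<in> U \<Longrightarrow> E x a \<Longrightarrow> H x"
  unfolding helow_def sub_def by blast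

lemma helow_subset: "H a \<Longrightarrow> Sub' b a \<Longrightarrow> H b"
  unfolding helow_def sub_def by blast

text \<open>The set \<open>t\<close> is its own witness for being helow: a member of
  \<open>t\<close> is low, so included in \<open>s\<close> by \<open>blevel_transitive\<close>, and
  its members are helow again.\<close>

lemma hpart_exists:
  assumes s: "s \<in> U" "BL s"
  shows "\<exists>t\<in>U. H t \<and> Sub' t s \<and> (\<forall>x\<in>U. E x t \<longleftrightarrow> H x \<and> E x s)"
proof -
  have "\<exists>t\<in>U. \<not> E t t \<and> (\<forall>x\<in>U. E x t \<longleftrightarrow> H x \<and> E x s)"
    by (rule separation[of "Helow 0" "\<lambda>_. s"]) (use s blevel_low in auto)
  then obtain t where t: "t \<in> U" "\<forall>x\<in>U. E x t \<longleftrightarrow> H x \<and> E x s" by blast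
  have "Sub' y t" if "y \<in> U" "E y t" for y
  proof -
    have y: "H y" "E y s" using that t by auto
    then have "Sub' y s" using blevel_transitive[OF s] helow_low that by blast
    then show ?thesis using y t helow_member unfolding sub_def by blast
  qed
  moreover have "\<forall>y\<in>U. E y t \<longrightarrow> \<not> E y y" using t helow_low by blast
  moreover have "Sub' t t" "Sub' t s" using t by (auto simp: sub_def)
  ultimately show ?thesis using t unfolding helow_def by blast
qed

lemma hpart_level:
  assumes s: "s \<in> U" "BL s" and t: "t \<in> U" "\<forall>x\<in>U. E x t \<longleftrightarrow> H x \<and> E x s"
  shows "level (hpart U E) E t"
proof -
  let ?N = "hpart U E"
  have s_low: "\<not> E s s" and s_pot: "potent s" using blevel_low blevel_potent s by auto
  have sub_N: "sub ?N E x y \<longleftrightarrow> Sub' x y" if "H x" for x y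
    using helow_member[OF that] unfolding sub_def by blast
  define ishp where "ishp y q \<longleftrightarrow> (\<forall>z\<in>U. E z y \<longleftrightarrow> H z \<and> E z q)" for y q
  \<comment> \<open>Separating \<open>h\<close> out of \<open>s\<close> loses no helow part: that of
    \<open>q\<close> in \<open>s\<close> is a subset of the low \<open>q\<close>, so it lies in
    \<open>s\<close> by potency.\<close>
  have "\<exists>h\<in>U. \<not> E h h \<and> (\<forall>x\<in>U. E x h \<longleftrightarrow> (\<exists>q\<in>U. E q s \<and> BL q \<and> ishp x q) \<and> E x s)"
    by (rule separation[of "Ex 1 (And (Mem 1 3) (And (BLevel 1)
          (All 2 (Iff (Mem 2 0) (And (Helow 2) (Mem 2 1))))))" "\<lambda>_. s"])
      (use s s_low in \<open>auto simp: ishp_def\<close>)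
  then obtain h where h: "h \<in> U" "\<forall>x\<in>U. E x h \<longleftrightarrow> (\<exists>q\<in>U. E q s \<and> BL q \<and> ishp x q) \<and> E x s" by blast
  have t_helow: "H t"
  proof -
    obtain t' where t': "t' \<in> U" "H t'" "\<forall>x\<in>U. E x t' \<longleftrightarrow> H x \<and> E x s" using hpart_exists[OF s] by blast
    then have "t' = t" using t by (intro extensionality) auto
    then show ?thesis using t' by simp
  qed
  have q_part: "\<exists>y\<in>U. H y \<and> ishp y q \<and> Sub' y q" if "q \<in> U" "BL q" for q
    using hpart_exists[OF that] unfolding ishp_def by blast
  have ishp_helow: "H y" if q: "q \<in> U" "BL q" "y \<in> U" "ishp y q" for y q
  proof -
    obtain y' where y': "y' \<in> U" "H y'" "ishp y' q" using q_part q by blast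
    then have "y' = y" using q unfolding ishp_def by (intro extensionality) auto
    then show ?thesis using y' by simp
  qed
  have h_sub_t: "Sub' h t" using h t ishp_helow unfolding sub_def by blast
  then have h_helow: "H h" using t_helow helow_subset by blast
  \<comment> \<open>One equivalence serves twice: for \<open>p\<close> a member of \<open>s\<close>
    it is the history condition, and for \<open>p = s\<close> it generates \<open>t\<close> from its
    members in \<open>h\<close>.\<close>
  have key: "E m y \<longleftrightarrow> (\<exists>c\<in>?N. E c y \<and> E c h \<and> sub ?N E m c)"
    if p: "p \<in> U" "BL p" "Sub' p s" and y: "y \<in> U" "ishp y p" and m: "m \<in> ?N" for p y m
  proof
    assume "E m y"
    then have mp: "E m p" using y m unfolding ishp_def by blast
    obtain q where q: "q \<in> U" "BL q" "E q p" "\<not> E q q" "Sub' m q"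
      using blevel_step[OF p(1,2)] m mp helow_low by blast
    obtain c where c: "c \<in> U" "H c" "ishp c q" "Sub' c q" using q_part q by blast
    have qs: "E q s" using q p unfolding sub_def by blast
    have "E c p" using blevel_potent[OF p(1,2)] q c unfolding potent_def by blast
    then have "E c s" "E c y" using p y c unfolding sub_def ishp_def by blast+
    moreover have "E c h" using h c q qs \<open>E c s\<close> by blast
    moreover have "Sub' m c" using q c m helow_member unfolding ishp_def sub_def by blast
    ultimately show "\<exists>c\<in>?N. E c y \<and> E c h \<and> sub ?N E m c" using c m sub_N by blast
  next
    assume "\<exists>c\<in>?N. E c y \<and> E c h \<and> sub ?N E m c"
    then obtain c where c: "c \<in> U" "H c" "E c y" "Sub' m c" using m sub_N by blast
    then have "E c p" using y unfolding ishp_def by blast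
    then have "E m p" using blevel_potent[OF p(1,2)] c m helow_low unfolding potent_def by blast
    then show "E m y" using y m unfolding ishp_def by blast
  qed
  have "history ?N E h"
    unfolding history_def
  proof (intro ballI impI)
    fix x m assume x: "x \<in> ?N" "E x h" and m: "m \<in> ?N"
    then obtain q where q: "q \<in> U" "E q s" "BL q" "ishp x q" using h by blast
    have "Sub' q s" using blevel_transitive[OF s] q blevel_low by blast
    then show "E m x \<longleftrightarrow> (\<exists>c\<in>?N. E c x \<and> E c h \<and> sub ?N E m c)"
      using key[of q x m] q x m by blast
  qed
  moreover have "E m t \<longleftrightarrow> (\<exists>c\<in>?N. E c h \<and> sub ?N E m c)" if m: "m \<in> ?N" for m
  proof -
    have "ishp t s" "Sub' s s" using t unfolding ishp_def by (auto simp: sub_def)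
    then have "E m t \<longleftrightarrow> (\<exists>c\<in>?N. E c t \<and> E c h \<and> sub ?N E m c)" using key[of s t m] s t m by blast
    then show ?thesis using h_sub_t unfolding sub_def[of U E h t] by blast
  qed
  ultimately show ?thesis unfolding level_def using h(1) h_helow by blast
qed

section \<open>The structure of helow sets\<close>

abbreviation "N \<equiv> hpart U E"

text \<open>Either \<open>u\<close> or its complement is low, and Separation cuts the empty set out
  of it. Its main use is that the helow domain is inhabited.\<close>

lemma empty_helow: "\<exists>z\<in>U. H z \<and> (\<forall>x\<in>U. \<not> E x z)"
proof -
  obtain a where a: "a \<in> U" "\<not> E a a" using complement[OF u] u by metis
  have "\<exists>z\<in>U. \<not> E z z \<and> (\<forall>x\<in>U. E x z \<longleftrightarrow> False \<and> E x a)"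
    by (rule separation[of Bot "\<lambda>_. a"]) (use a in auto)
  then obtain z where "z \<in> U" "\<forall>x\<in>U. \<not> E x z" by blast
  then show ?thesis unfolding helow_def sub_def by blast
qed

lemma helow_separation:
  assumes "wf p" "\<forall>x. e x \<in> U" and a: "a \<in> U" "H a"
    and P: "\<And>x. x \<in> U \<Longrightarrow> P x \<longleftrightarrow> sat U E Q (e(0 := x)) r p"
  shows "\<exists>b\<in>N. \<forall>x\<in>U. E x b \<longleftrightarrow> P x \<and> E x a"
proof -
  obtain b where b: "b \<in> U" "\<forall>x\<in>U. E x b \<longleftrightarrow> P x \<and> E x a"
    using separation[OF assms(1,2) a(1) helow_low[OF a] P] by blast
  then have "H b" using helow_subset[OF a(2)] by (auto simp: sub_def)
  then show ?thesis using b by blast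
qed

lemma sub_hpart: "H x \<Longrightarrow> sub N E x y \<longleftrightarrow> Sub' x y"
  using helow_member unfolding sub_def by blast

lemma valid_Ext: "valid N E Q ax_Ext"
proof -
  have "a = b" if "a \<in> N" "b \<in> N" "\<forall>x\<in>N. E x a \<longleftrightarrow> E x b" for a b
    using that helow_member by (intro extensionality) blast+
  then show ?thesis by (simp add: valid_def ax_Ext_def)
qed

lemma valid_Sep: "valid N E Q ax_Sep"
proof -
  have "\<exists>b\<in>N. \<forall>x\<in>N. E x b \<longleftrightarrow> X [x] \<and> E x a" if X: "X \<in> Q 1" and a: "a \<in> N" for X a
  proof -
    obtain b where b: "b \<in> U" "\<forall>x\<in>U. E x b \<longleftrightarrow> X [x] \<and> E x a"
      using separation_rel[OF X] a helow_low by blast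
    then have "H b" using helow_subset[of a] a by (auto simp: sub_def)
    then show ?thesis using b by blast
  qed
  then show ?thesis by (simp add: valid_def ax_Sep_def)
qed

lemma valid_Strat: "valid N E Q ax_Strat"
proof -
  have "\<exists>t\<in>N. level N E t \<and> sub N E a t" if a: "a \<in> N" for a
  proof -
    obtain s where s: "s \<in> U" "BL s" "Sub' a s" using stratification[of a] a helow_low by blast
    obtain t where t: "t \<in> U" "H t" "\<forall>x\<in>U. E x t \<longleftrightarrow> H x \<and> E x s" using hpart_exists[OF s(1,2)] by blast
    have "Sub' a t" using a s t helow_member unfolding sub_def by blast
    then show ?thesis using hpart_level[OF s(1,2) t(1,3)] t a sub_hpart by blast
  qed
  then show ?thesis by (simp add: valid_def ax_Strat_def)
qed

lemma LT_valid: "\<forall>p\<in>LT. valid N E Q p"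
  using valid_Ext valid_Sep valid_Strat by (simp add: LT_def)

text \<open>A helow \<open>a\<close> is included in a boolean-level \<open>s\<close>, which belongs
  to a further one \<open>q\<close>; potency puts \<open>a\<close> into \<open>q\<close>, hence into
  its helow part.\<close>

lemma valid_Endless:
  assumes "valid U E Q ax_EndlessN"
  shows "valid N E Q ax_Endless"
proof -
  have endless: "\<exists>t\<in>U. BL t \<and> E s t" if "s \<in> U" "BL s" for s
    using valid_sat[OF assms] that by (simp add: ax_EndlessN_def)
  have "\<exists>t\<in>N. level N E t \<and> E a t" if a: "a \<in> N" for a
  proof -
    obtain s where s: "s \<in> U" "BL s" "Sub' a s" using stratification[of a] a helow_low by blast
    obtain q where q: "q \<in> U" "BL q" "E s q" using endless s by blast
    obtain t where t: "t \<in> U" "H t" "\<forall>x\<in>U. E x t \<longleftrightarrow> H x \<and> E x q" using hpart_exists[OF q(1,2)] by blast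
    have "E a q" using blevel_potent[OF q(1,2)] s q blevel_low[OF s(1,2)] a unfolding potent_def by blast
    then show ?thesis using hpart_level[OF q(1,2) t(1,3)] t a by blast
  qed
  then show ?thesis by (simp add: valid_def ax_Endless_def)
qed

text \<open>Boolean-levels act as ranks: take a minimal one including some \<open>x\<close> in
  \<open>a\<close>. A member \<open>y\<close> of \<open>x\<close> that is also in \<open>a\<close>
  would be included in a boolean-level belonging to the minimal one.\<close>

lemma valid_Found: "valid N E Q ax_Found"
proof -
  have "\<exists>x\<in>N. E x a \<and> (\<forall>y\<in>N. E y x \<longrightarrow> \<not> E y a)" if a: "a \<in> N" and b: "b \<in> N" "E b a" for a b
  proof -
    define F where "F s \<longleftrightarrow> BL s \<and> (\<exists>x\<in>U. E x a \<and> Sub' x s)" for s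
    obtain s0 where s0: "s0 \<in> U" "BL s0" "Sub' b s0" using stratification[of b] b helow_low by blast
    have "\<exists>s\<in>U. F s \<and> (\<forall>z\<in>U. F z \<longrightarrow> \<not> E z s)"
    proof (rule potent_minimal[of "And (BLevel 1) (Ex 3 (And (Mem 3 2) (Sub 3 1)))" "\<lambda>_. a"])
      show "F s0" using s0 b unfolding F_def by blast
    qed (use a s0 blevel_low blevel_potent in \<open>auto simp: F_def\<close>)
    then obtain s x where s: "s \<in> U" "BL s" and min: "\<forall>z\<in>U. F z \<longrightarrow> \<not> E z s"
      and x: "x \<in> U" "E x a" "Sub' x s" unfolding F_def by blast
    have "\<not> E y a" if y: "y \<in> N" "E y x" for y
    proof
      assume "E y a"
      have "E y s" using x y unfolding sub_def by blast
      then obtain q where "q \<in> U" "BL q" "E q s" "Sub' y q"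
        using blevel_step[OF s] y helow_low by blast
      then show False using min \<open>E y a\<close> y unfolding F_def by blast
    qed
    then show ?thesis using x a helow_member by blast
  qed
  then show ?thesis by (auto simp: valid_def ax_Found_def)
qed

end

section \<open>The axioms of ZF for helow sets\<close>

locale blt_zf_model = blt_model +
  assumes infinityN: "valid U E Q ax_InfinityN" and unboundedN: "valid U E Q ax_UnboundedN"
begin

lemma infinity:
  obtains s q where "s \<in> U" "BL s" "q \<in> U" "BL q" "E q s"
    "\<forall>q\<in>U. BL q \<and> E q s \<longrightarrow> (\<exists>r\<in>U. BL r \<and> E q r \<and> E r s)"
proof -
  have "\<exists>s\<in>U. BL s \<and> (\<exists>q\<in>U. BL q \<and> E q s) \<and>
      (\<forall>q\<in>U. BL q \<and> E q s \<longrightarrow> (\<exists>r\<in>U. BL r \<and> E q r \<and> E r s))"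
    using valid_sat[OF infinityN] by (simp add: ax_InfinityN_def)
  then show thesis using that by blast
qed

lemma unbounded:
  assumes "X \<in> Q 2" "a \<in> U" "\<not> E a a"
    and "\<forall>x\<in>U. E x a \<longrightarrow> (\<exists>y\<in>U. X [x, y] \<and> (\<forall>z\<in>U. X [x, z] \<longrightarrow> z = y))"
  shows "\<exists>s\<in>U. BL s \<and> (\<forall>x\<in>U. E x a \<longrightarrow> (\<forall>y\<in>U. X [x, y] \<longrightarrow> E y s))"
  using valid_sat[OF unboundedN] assms by (simp add: ax_UnboundedN_def FunctionalOn_def Let_def)

text \<open>Unbounded applies to a function onto \<open>a\<close> and \<open>b\<close> from a low
  set with two members. The limit level of Infinity is such a set: it has members \<open>q\<close>
  and \<open>p\<close> with \<open>q\<close> in \<open>p\<close>, distinct because boolean-levels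
  are low.\<close>

lemma blevel_containing_two:
  assumes "a \<in> U" "b \<in> U"
  shows "\<exists>s\<in>U. BL s \<and> E a s \<and> E b s"
proof -
  obtain s q where s: "s \<in> U" "BL s" and q: "q \<in> U" "BL q" "E q s"
    and lim: "\<forall>q\<in>U. BL q \<and> E q s \<longrightarrow> (\<exists>r\<in>U. BL r \<and> E q r \<and> E r s)" by (rule infinity)
  obtain p where p: "p \<in> U" "BL p" "E q p" "E p s" using lim q by blast
  have "q \<noteq> p" using blevel_low p by blast
  let ?P = "\<lambda>x y. (x = q \<and> y = a) \<or> (x \<noteq> q \<and> y = b)"
  have "\<exists>X\<in>Q 2. \<forall>x\<in>U. \<forall>y\<in>U. X [x, y] \<longleftrightarrow> ?P x y"
    by (rule comprehension2[of "Or (And (Eq 0 2) (Eq 1 3)) (And (Neg (Eq 0 2)) (Eq 1 4))"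
          "(\<lambda>_. q)(3 := a, 4 := b)"]) (use assms q in auto)
  then obtain X where X: "X \<in> Q 2" "\<forall>x\<in>U. \<forall>y\<in>U. X [x, y] \<longleftrightarrow> ?P x y" by blast
  obtain t where t: "t \<in> U" "BL t" "\<forall>x\<in>U. E x s \<longrightarrow> (\<forall>y\<in>U. X [x, y] \<longrightarrow> E y t)"
    using unbounded[OF X(1) s(1) blevel_low[OF s]] X(2) assms by auto
  then have "E a t" "E b t" using X(2) p q \<open>q \<noteq> p\<close> assms by blast+
  then show ?thesis using t by blast
qed

lemma hpart_containing_two:
  assumes "a \<in> N" "b \<in> N"
  obtains s t where "s \<in> U" "BL s" "t \<in> U" "H t" "\<forall>x\<in>U. E x t \<longleftrightarrow> H x \<and> E x s" "E a t" "E b t"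
proof -
  obtain s where s: "s \<in> U" "BL s" "E a s" "E b s" using blevel_containing_two[of a b] assms by blast
  obtain t where "t \<in> U" "H t" "\<forall>x\<in>U. E x t \<longleftrightarrow> H x \<and> E x s" using hpart_exists[OF s(1,2)] by blast
  then show thesis using that s assms by blast
qed

lemma valid_Pair: "valid N E Q ax_Pair"
proof -
  have "\<exists>c\<in>N. \<forall>x\<in>N. E x c \<longleftrightarrow> x = a \<or> x = b" if ab: "a \<in> N" "b \<in> N" for a b
  proof -
    obtain s t where t: "t \<in> U" "H t" "E a t" "E b t" using hpart_containing_two[OF ab] by metis
    have "\<exists>c\<in>N. \<forall>x\<in>U. E x c \<longleftrightarrow> (x = a \<or> x = b) \<and> E x t"
      by (rule helow_separation[of "Or (Eq 0 1) (Eq 0 2)" "(\<lambda>_. a)(2 := b)"]) (use ab t in auto)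
    then show ?thesis using t by blast
  qed
  then show ?thesis by (simp add: valid_def ax_Pair_def)
qed

text \<open>The transitive set \<open>c\<close> witnessing that \<open>a\<close> is helow also
  witnesses this for itself, and it contains the members of members of \<open>a\<close>; the union
  is cut out of \<open>c\<close>.\<close>

lemma valid_Union: "valid N E Q ax_Union"
proof -
  have "\<exists>b\<in>N. \<forall>x\<in>N. E x b \<longleftrightarrow> (\<exists>y\<in>N. E y a \<and> E x y)" if a: "a \<in> N" for a
  proof -
    obtain c where c: "c \<in> U" "\<forall>y\<in>U. E y c \<longrightarrow> Sub' y c" "Sub' a c" "\<forall>y\<in>U. E y c \<longrightarrow> \<not> E y y"
      using a unfolding helow_def by blast
    have "Sub' c c" by (simp add: sub_def)
    then have "H c" unfolding helow_def using c by blast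
    have "\<exists>b\<in>N. \<forall>x\<in>U. E x b \<longleftrightarrow> (\<exists>y\<in>U. E y a \<and> E x y) \<and> E x c"
      by (rule helow_separation[of "Ex 1 (And (Mem 1 2) (Mem 0 1))" "\<lambda>_. a"]) (use a c \<open>H c\<close> in auto)
    then obtain b where b: "b \<in> N" "\<forall>x\<in>U. E x b \<longleftrightarrow> (\<exists>y\<in>U. E y a \<and> E x y) \<and> E x c" ..
    have "E x c" if "x \<in> U" "y \<in> U" "E y a" "E x y" for x y
      using that c unfolding sub_def by blast
    moreover have "y \<in> N" if "y \<in> U" "E y a" for y using that a helow_member by blast
    ultimately have "E x b \<longleftrightarrow> (\<exists>y\<in>N. E y a \<and> E x y)" if "x \<in> N" for x
      using b(2) that by blast
    then show ?thesis using b(1) by blast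
  qed
  then show ?thesis by (simp add: valid_def ax_Union_def)
qed

text \<open>A boolean-level containing \<open>a\<close> contains all subsets of \<open>a\<close> by
  potency, so its helow part bounds the power set.\<close>

lemma valid_Power: "valid N E Q ax_Power"
proof -
  have "\<exists>b\<in>N. \<forall>x\<in>N. E x b \<longleftrightarrow> sub N E x a" if a: "a \<in> N" for a
  proof -
    obtain s t where s: "s \<in> U" "BL s" and t: "t \<in> U" "H t" "\<forall>x\<in>U. E x t \<longleftrightarrow> H x \<and> E x s" "E a t"
      using hpart_containing_two[OF a a] by metis
    have "\<exists>b\<in>N. \<forall>x\<in>U. E x b \<longleftrightarrow> Sub' x a \<and> E x t"
      by (rule helow_separation[of "Sub 0 1" "\<lambda>_. a"]) (use a t in auto)
    moreover have "E x t" if "x \<in> N" "Sub' x a" for x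
      using that t a blevel_potent[OF s] helow_low unfolding potent_def by blast
    ultimately show ?thesis using sub_hpart by blast
  qed
  then show ?thesis by (simp add: valid_def ax_Power_def)
qed

lemma valid_Inf: "valid N E Q ax_Inf"
proof -
  obtain s q where s: "s \<in> U" "BL s" and q: "q \<in> U" "BL q" "E q s"
    and lim: "\<forall>q\<in>U. BL q \<and> E q s \<longrightarrow> (\<exists>r\<in>U. BL r \<and> E q r \<and> E r s)" by (rule infinity)
  have s_pot: "potent s" using blevel_potent[OF s] .
  obtain w where w: "w \<in> U" "H w" "\<forall>x\<in>U. E x w \<longleftrightarrow> H x \<and> E x s" using hpart_exists[OF s] by blast
  obtain z where z: "z \<in> U" "H z" "\<forall>x\<in>U. \<not> E x z" using empty_helow by blast
  have "Sub' z q" using z by (auto simp: sub_def)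
  then have "E z w" using s_pot q z w blevel_low[OF q(1,2)] unfolding potent_def by blast
  then have zero: "\<exists>z\<in>N. E z w \<and> (\<forall>x\<in>N. \<not> E x z)" using z by blast
  have succ: "\<exists>y\<in>N. E y w \<and> (\<forall>v\<in>N. E v y \<longleftrightarrow> E v x \<or> v = x)" if x: "x \<in> N" "E x w" for x
  proof -
    have "E x s" "\<not> E x x" using x w helow_low by blast+
    then obtain q where q: "q \<in> U" "BL q" "E q s" "Sub' x q" using blevel_step[OF s] x by blast
    \<comment> \<open>The limit property gives room above \<open>q\<close>: in \<open>p\<close> the
      set \<open>x\<close> is both a member and a subset, so its successor is a subset of
      \<open>p\<close> and thus a member of \<open>s\<close>.\<close>
    obtain p where p: "p \<in> U" "BL p" "E q p" "E p s" using lim q by blast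
    have low: "\<not> E q q" "\<not> E p p" using blevel_low p q by auto
    obtain t where t: "t \<in> U" "H t" "Sub' t p" "\<forall>x\<in>U. E x t \<longleftrightarrow> H x \<and> E x p" using hpart_exists[OF p(1,2)] by blast
    have "E x p" using blevel_potent[OF p(1,2)] p q low x unfolding potent_def by blast
    moreover have "Sub' x p" using blevel_transitive[OF p(1,2)] q p low unfolding sub_def by blast
    ultimately have xt: "E v t" if "v \<in> U" "E v x \<or> v = x" for v
      using that x t helow_member unfolding sub_def by blast
    have "\<exists>y\<in>N. \<forall>v\<in>U. E v y \<longleftrightarrow> (E v x \<or> v = x) \<and> E v t"
      by (rule helow_separation[of "Or (Mem 0 1) (Eq 0 1)" "\<lambda>_. x"]) (use x t in auto)
    then obtain y where y: "y \<in> N" "\<forall>v\<in>U. E v y \<longleftrightarrow> E v x \<or> v = x" using xt by blast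
    have "Sub' y p" using y xt t(3) unfolding sub_def by blast
    then have "E y s" using s_pot p low y unfolding potent_def by blast
    then show ?thesis using y w by blast
  qed
  have "\<exists>w\<in>N. (\<exists>z\<in>N. E z w \<and> (\<forall>x\<in>N. \<not> E x z)) \<and>
      (\<forall>x\<in>N. E x w \<longrightarrow> (\<exists>y\<in>N. E y w \<and> (\<forall>v\<in>N. E v y \<longleftrightarrow> E v x \<or> v = x)))"
    by (rule bexI[of _ w], intro conjI ballI impI, rule zero, rule succ) (use w in auto)
  then show ?thesis by (simp add: valid_def ax_Inf_def)
qed

lemma valid_Repl: "valid N E Q ax_Repl"
proof -
  have "\<exists>b\<in>N. \<forall>y\<in>N. E y b \<longleftrightarrow> (\<exists>x\<in>N. E x a \<and> X [x, y])"
    if X: "X \<in> Q 2" and a: "a \<in> N"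
      and fn: "\<forall>x\<in>N. E x a \<longrightarrow> (\<exists>y\<in>N. X [x, y] \<and> (\<forall>z\<in>N. X [x, z] \<longrightarrow> z = y))" for X a
  proof -
    \<comment> \<open>As the value of a relation variable, \<open>X\<close> becomes a parameter for
      comprehension and Separation.\<close>
    interpret X: blt_model U E Q u "r((0, 2) := X)"
      using henkin BLT u r X by unfold_locales auto
    \<comment> \<open>\<open>X\<close> is functional among helow values only; discarding the others
      makes it functional over \<open>U\<close>, as Unbounded demands.\<close>
    have "\<exists>Y\<in>Q 2. \<forall>x\<in>U. \<forall>y\<in>U. Y [x, y] \<longleftrightarrow> X [x, y] \<and> H y"
      by (rule X.comprehension2[of "And (Rel (0, 2) [0, 1]) (Helow 1)" "\<lambda>_. a"]) (use a in auto)
    then obtain Y where Y: "Y \<in> Q 2" "\<forall>x\<in>U. \<forall>y\<in>U. Y [x, y] \<longleftrightarrow> X [x, y] \<and> H y" by blast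
    have "\<forall>x\<in>U. E x a \<longrightarrow> (\<exists>y\<in>U. Y [x, y] \<and> (\<forall>z\<in>U. Y [x, z] \<longrightarrow> z = y))"
    proof (intro ballI impI)
      fix x assume x: "x \<in> U" "E x a"
      then have "x \<in> N" using a helow_member by blast
      then obtain y where "y \<in> N" "X [x, y]" "\<forall>z\<in>N. X [x, z] \<longrightarrow> z = y" using fn x by blast
      then show "\<exists>y\<in>U. Y [x, y] \<and> (\<forall>z\<in>U. Y [x, z] \<longrightarrow> z = y)" using Y x by blast
    qed
    then obtain s where s: "s \<in> U" "BL s" "\<forall>x\<in>U. E x a \<longrightarrow> (\<forall>y\<in>U. Y [x, y] \<longrightarrow> E y s)"
      using unbounded[OF Y(1)] a helow_low by blast
    obtain t where t: "t \<in> U" "H t" "\<forall>x\<in>U. E x t \<longleftrightarrow> H x \<and> E x s" using hpart_exists[OF s(1,2)] by blast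
    have "\<exists>b\<in>N. \<forall>y\<in>U. E y b \<longleftrightarrow> (\<exists>x\<in>U. E x a \<and> X [x, y]) \<and> E y t"
      by (rule X.helow_separation[of "Ex 1 (And (Mem 1 2) (Rel (0, 2) [1, 0]))" "\<lambda>_. a"])
        (use a t in auto)
    then obtain b where b: "b \<in> N" "\<forall>y\<in>U. E y b \<longleftrightarrow> (\<exists>x\<in>U. E x a \<and> X [x, y]) \<and> E y t" ..
    have "E y t" if "y \<in> N" "x \<in> U" "E x a" "X [x, y]" for x y
      using that s t Y by blast
    moreover have "x \<in> N" if "x \<in> U" "E x a" for x using that a helow_member by blast
    ultimately have "E y b \<longleftrightarrow> (\<exists>x\<in>N. E x a \<and> X [x, y])" if "y \<in> N" for y
      using b(2) that by blast
    then show ?thesis using b(1) by blast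
  qed
  then show ?thesis by (simp add: valid_def ax_Repl_def FunctionalOn_def Let_def)
qed

lemma ZF_valid: "\<forall>p\<in>ZF. valid N E Q p"
  using valid_Ext valid_Found valid_Pair valid_Union valid_Power valid_Inf valid_Sep valid_Repl
  by (simp add: ZF_def)

end

section \<open>Transfer of derivability\<close>

lemma deriv_relh:
  assumes "sentence \<phi>" "T \<turnstile> \<phi>" "finite S" "BLT \<subseteq> S"
    and models: "\<And>(U :: nat set) E Q u r. blt_model U E Q u r \<Longrightarrow> \<forall>p\<in>S. valid U E Q p \<Longrightarrow>
      \<forall>p\<in>T. valid (hpart U E) E Q p"
  shows "S \<turnstile> relh \<phi>"
proof (rule ccontr)
  assume "\<not> S \<turnstile> relh \<phi>"
  have closed: "fv \<phi> = {}" "frv \<phi> = {}" using assms(1) by (auto simp: sentence_def)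
  obtain U :: "nat set" and E Q where M: "henkin U E Q" "\<forall>p\<in>S. valid U E Q p" "\<not> valid U E Q (relh \<phi>)"
    by (rule completeness[of S "relh \<phi>"]) (use assms(3) closed \<open>\<not> S \<turnstile> relh \<phi>\<close> in auto)
  then obtain e r where e: "\<forall>x. e x \<in> U" and r: "\<forall>R. r R \<in> Q (snd R)"
    and false: "\<not> sat (hpart U E) E Q e r \<phi>" unfolding valid_def sat_relh by blast
  interpret blt_model U E Q "e 0" r
    using M(1,2) assms(4) e r by unfold_locales auto
  \<comment> \<open>An assignment into the helow part requires a helow set. As \<phi> is closed,
    this assignment can replace \<open>e\<close>, whose values are only known to lie in
    \<open>U\<close>.\<close>
  obtain z where z: "z \<in> hpart U E" using empty_helow by blast
  have "\<forall>p\<in>T. valid (hpart U E) E Q p" using models M(2) blt_model_axioms by blast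
  then have "valid (hpart U E) E Q \<phi>" using deriv_valid[OF assms(2) henkin_hpart[OF M(1)]] by blast
  then have "sat (hpart U E) E Q (\<lambda>_. z) r \<phi>" by (rule validD) (use z r in auto)
  moreover have "sat (hpart U E) E Q (\<lambda>_. z) r \<phi> = sat (hpart U E) E Q e r \<phi>"
    by (rule sat_cong) (use closed in auto)
  ultimately show False using false by blast
qed

theorem theorem15:
  assumes "sentence \<phi>"
  shows "(LT \<turnstile> \<phi> \<longrightarrow> BLT \<turnstile> relh \<phi>)
       \<and> (LTplus \<turnstile> \<phi> \<longrightarrow> BLTplus \<turnstile> relh \<phi>)
       \<and> (ZF \<turnstile> \<phi> \<longrightarrow> BLT_ZF \<turnstile> relh \<phi>)"
proof (intro conjI impI)
  have fin: "finite BLT" by (simp add: BLT_def)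
  show "BLT \<turnstile> relh \<phi>" if "LT \<turnstile> \<phi>"
    using that by (rule deriv_relh[OF assms]) (auto simp: fin blt_model.LT_valid)
  show "BLTplus \<turnstile> relh \<phi>" if "LTplus \<turnstile> \<phi>"
    using that by (rule deriv_relh[OF assms])
      (auto simp: fin BLTplus_def LTplus_def blt_model.LT_valid blt_model.valid_Endless)
  show "BLT_ZF \<turnstile> relh \<phi>" if "ZF \<turnstile> \<phi>"
  proof (rule deriv_relh[OF assms that])
    fix U :: "nat set" and E Q u r
    assume "blt_model U E Q u r" "\<forall>p\<in>BLT_ZF. valid U E Q p"
    then have "blt_zf_model U E Q u r"
      by (simp add: blt_zf_model_def blt_zf_model_axioms_def BLT_ZF_def)
    then show "\<forall>p\<in>ZF. valid (hpart U E) E Q p" by (rule blt_zf_model.ZF_valid)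
  qed (auto simp: fin BLT_ZF_def)
qed

end
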